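(* The theory $\mathsf{ZF}$ (Zermelo–Fraenkel set theory without the Axiom of Choice) proves that the following two statements are equivalent: (1) the Boolean Prime Ideal theorem; (2) for every partial order $\mathbb P$ and every centred family $\mathcal A$ of finite antichains of $\mathbb P$, there exists an $\mathcal A$-generic 2-linked subset $G\subseteq\mathbb P$.
   Context: The Boolean Prime Ideal theorem is the statement that every nontrivial Boolean algebra has a prime ideal. Let $\mathbb P$ be a partially ordered set with order $\leq$. Two elements $p,q\in\mathbb P$ are compatible if there exists $r\in\mathbb P$ with $r\leq p$ and $r\leq q$; otherwise they are incompatible. A subset $A\subseteq\mathbb P$ is an antichain if any two distinct elements of $A$ are incompatible. A subset $G\subseteq\mathbb P$ is 2-linked if every two elements of $G$ are compatible. A family $\mathcal A$ of antichains of $\mathbb P$ is centred if for every choice of finitely many antichains $A_1,\ldots,A_n\in\mathcal A$ ($n\geq 1$) there exist $p\in\mathbb P$ and $a_1\in A_1,\ldots,a_n\in A_n$ such that $p\leq a_k$ for all $1\leq k\leq n$. A subset $G\subseteq\mathbb P$ is $\mathcal A$-generic if $G\cap A\neq\varnothing$ for every $A\in\mathcal A$. *)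

theory Defs
  imports Main
begin

section \<open>First-order logic over the signature of set theory\<close>

text \<open>
  HOL itself validates the axiom of choice, so set theory is treated as an object theory:
  formulas are a datatype (with de Bruijn indices), and provability is an inductive predicate.
  Since the only terms are variables, substitution is renaming of indices.
\<close>

datatype fm =
    Mem nat nat
  | Eql nat nat
  | Falsum
  | Imp fm fm
  | Forall fm

primrec ren :: "(nat \<Rightarrow> nat) \<Rightarrow> fm \<Rightarrow> fm" where
  "ren f (Mem i j) = Mem (f i) (f j)"
| "ren f (Eql i j) = Eql (f i) (f j)"
| "ren f Falsum = Falsum"
| "ren f (Imp p q) = Imp (ren f p) (ren f q)"
| "ren f (Forall p) = Forall (ren (case_nat 0 (\<lambda>i. Suc (f i))) p)"

text \<open>Instantiation of the outermost bound variable (index 0) of the body of a quantifier.\<close>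

definition inst :: "nat \<Rightarrow> fm \<Rightarrow> fm" where
  "inst t p = ren (case_nat t (\<lambda>i. i)) p"

primrec fv :: "fm \<Rightarrow> nat set" where
  "fv (Mem i j) = {i, j}"
| "fv (Eql i j) = {i, j}"
| "fv Falsum = {}"
| "fv (Imp p q) = fv p \<union> fv q"
| "fv (Forall p) = {i. Suc i \<in> fv p}"

text \<open>
  Classical natural deduction with equality; in \<open>AllI\<close> the assumptions are shifted, so that
  index 0 is the eigenvariable.
\<close>

inductive proves :: "fm set \<Rightarrow> fm \<Rightarrow> bool" (infix "\<turnstile>" 50) where
  Assm: "p \<in> \<Gamma> \<Longrightarrow> \<Gamma> \<turnstile> p"
| ImpI: "insert p \<Gamma> \<turnstile> q \<Longrightarrow> \<Gamma> \<turnstile> Imp p q"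
| ImpE: "\<Gamma> \<turnstile> Imp p q \<Longrightarrow> \<Gamma> \<turnstile> p \<Longrightarrow> \<Gamma> \<turnstile> q"
| Contr: "insert (Imp p Falsum) \<Gamma> \<turnstile> Falsum \<Longrightarrow> \<Gamma> \<turnstile> p"
| AllI: "ren Suc ` \<Gamma> \<turnstile> p \<Longrightarrow> \<Gamma> \<turnstile> Forall p"
| AllE: "\<Gamma> \<turnstile> Forall p \<Longrightarrow> \<Gamma> \<turnstile> inst t p"
| EqlI: "\<Gamma> \<turnstile> Eql t t"
| EqlE: "\<Gamma> \<turnstile> Eql s t \<Longrightarrow> \<Gamma> \<turnstile> inst s p \<Longrightarrow> \<Gamma> \<turnstile> inst t p"

section \<open>Notation for object-level formulas\<close>

text \<open>
  To write formulas with named bound variables, an object-level formula is represented as a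
  function of the number \<open>d\<close> of quantifiers above it, and a variable by its de Bruijn
  \<^emph>\<open>level\<close> (the quantifiers are counted from the outside).  The variable of level \<open>x\<close> has
  index \<open>d - Suc x\<close> below \<open>d\<close> quantifiers.  A formula \<open>P\<close> built with the
  operators below and without free levels denotes the sentence \<open>P 0\<close>.
\<close>

type_synonym var = nat
type_synonym form = "nat \<Rightarrow> fm"

definition fmem :: "var \<Rightarrow> var \<Rightarrow> form" (infix "\<^bold>\<in>" 55) where
  "x \<^bold>\<in> y = (\<lambda>d. Mem (d - Suc x) (d - Suc y))"

definition feql :: "var \<Rightarrow> var \<Rightarrow> form" (infix "\<^bold>=" 55) where
  "x \<^bold>= y = (\<lambda>d. Eql (d - Suc x) (d - Suc y))"

definition ffalse :: form ("\<^bold>\<bottom>") where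
  "\<^bold>\<bottom> = (\<lambda>d. Falsum)"

definition fimp :: "form \<Rightarrow> form \<Rightarrow> form" (infixr "\<^bold>\<longrightarrow>" 25) where
  "(P \<^bold>\<longrightarrow> Q) = (\<lambda>d. Imp (P d) (Q d))"

definition fall :: "(var \<Rightarrow> form) \<Rightarrow> form" (binder "\<^bold>\<forall>" 10) where
  "fall F = (\<lambda>d. Forall (F d (Suc d)))"

definition fneg :: "form \<Rightarrow> form" ("\<^bold>\<not> _" [40] 40) where
  "(\<^bold>\<not> P) = (P \<^bold>\<longrightarrow> \<^bold>\<bottom>)"

definition fconj :: "form \<Rightarrow> form \<Rightarrow> form" (infixr "\<^bold>\<and>" 35) where
  "(P \<^bold>\<and> Q) = (\<^bold>\<not> (P \<^bold>\<longrightarrow> \<^bold>\<not> Q))"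

definition fdisj :: "form \<Rightarrow> form \<Rightarrow> form" (infixr "\<^bold>\<or>" 30) where
  "(P \<^bold>\<or> Q) = (\<^bold>\<not> P \<^bold>\<longrightarrow> Q)"

definition fiff :: "form \<Rightarrow> form \<Rightarrow> form" (infixr "\<^bold>\<longleftrightarrow>" 25) where
  "(P \<^bold>\<longleftrightarrow> Q) = ((P \<^bold>\<longrightarrow> Q) \<^bold>\<and> (Q \<^bold>\<longrightarrow> P))"

definition fex :: "(var \<Rightarrow> form) \<Rightarrow> form" (binder "\<^bold>\<exists>" 10) where
  "fex F = (\<^bold>\<not> (\<^bold>\<forall>x. \<^bold>\<not> F x))"

section \<open>Basic set-theoretic notions\<close>

definition fsubset :: "var \<Rightarrow> var \<Rightarrow> form" (infix "\<^bold>\<subseteq>" 55) where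
  "x \<^bold>\<subseteq> y = (\<^bold>\<forall>z. z \<^bold>\<in> x \<^bold>\<longrightarrow> z \<^bold>\<in> y)"

definition is_empty :: "var \<Rightarrow> form" where
  "is_empty x = (\<^bold>\<forall>z. \<^bold>\<not> z \<^bold>\<in> x)"

text \<open>\<open>y = x \<union> {x}\<close>\<close>

definition is_succ :: "var \<Rightarrow> var \<Rightarrow> form" where
  "is_succ x y = (\<^bold>\<forall>z. z \<^bold>\<in> y \<^bold>\<longleftrightarrow> z \<^bold>\<in> x \<^bold>\<or> z \<^bold>= x)"

definition is_inductive :: "var \<Rightarrow> form" where
  "is_inductive w = ((\<^bold>\<exists>e. is_empty e \<^bold>\<and> e \<^bold>\<in> w) \<^bold>\<and>
     (\<^bold>\<forall>x. x \<^bold>\<in> w \<^bold>\<longrightarrow> (\<^bold>\<exists>y. is_succ x y \<^bold>\<and> y \<^bold>\<in> w)))"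

text \<open>\<open>n\<close> is a von Neumann natural number, i.e. an element of the least inductive set.\<close>

definition is_nat :: "var \<Rightarrow> form" where
  "is_nat n = (\<^bold>\<forall>w. is_inductive w \<^bold>\<longrightarrow> n \<^bold>\<in> w)"

text \<open>\<open>p = {a, b}\<close>\<close>

definition is_upair :: "var \<Rightarrow> var \<Rightarrow> var \<Rightarrow> form" where
  "is_upair a b p = (\<^bold>\<forall>z. z \<^bold>\<in> p \<^bold>\<longleftrightarrow> z \<^bold>= a \<^bold>\<or> z \<^bold>= b)"

text \<open>\<open>p = (a, b) = {{a}, {a, b}}\<close>\<close>

definition is_pair :: "var \<Rightarrow> var \<Rightarrow> var \<Rightarrow> form" where
  "is_pair a b p = (\<^bold>\<exists>s. \<^bold>\<exists>t. is_upair a a s \<^bold>\<and> is_upair a b t \<^bold>\<and> is_upair s t p)"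

text \<open>\<open>(a, b) \<in> R\<close>\<close>

definition rel :: "var \<Rightarrow> var \<Rightarrow> var \<Rightarrow> form" where
  "rel R a b = (\<^bold>\<exists>p. is_pair a b p \<^bold>\<and> p \<^bold>\<in> R)"

text \<open>\<open>D = A \<times> B\<close>\<close>

definition is_prod :: "var \<Rightarrow> var \<Rightarrow> var \<Rightarrow> form" where
  "is_prod A B D = (\<^bold>\<forall>p. p \<^bold>\<in> D \<^bold>\<longleftrightarrow> (\<^bold>\<exists>a. \<^bold>\<exists>b. a \<^bold>\<in> A \<^bold>\<and> b \<^bold>\<in> B \<^bold>\<and> is_pair a b p))"

text \<open>\<open>R \<subseteq> A \<times> B\<close>\<close>

definition is_rel :: "var \<Rightarrow> var \<Rightarrow> var \<Rightarrow> form" where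
  "is_rel R A B = (\<^bold>\<exists>D. is_prod A B D \<^bold>\<and> R \<^bold>\<subseteq> D)"

text \<open>\<open>f : A \<rightarrow> B\<close>\<close>

definition is_fun :: "var \<Rightarrow> var \<Rightarrow> var \<Rightarrow> form" where
  "is_fun f A B = (is_rel f A B \<^bold>\<and>
     (\<^bold>\<forall>a. a \<^bold>\<in> A \<^bold>\<longrightarrow> (\<^bold>\<exists>b. rel f a b \<^bold>\<and> (\<^bold>\<forall>c. rel f a c \<^bold>\<longrightarrow> c \<^bold>= b))))"

definition is_bij :: "var \<Rightarrow> var \<Rightarrow> var \<Rightarrow> form" where
  "is_bij f A B = (is_fun f A B \<^bold>\<and>
     (\<^bold>\<forall>a. \<^bold>\<forall>a'. \<^bold>\<forall>b. rel f a b \<^bold>\<and> rel f a' b \<^bold>\<longrightarrow> a \<^bold>= a') \<^bold>\<and>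
     (\<^bold>\<forall>b. b \<^bold>\<in> B \<^bold>\<longrightarrow> (\<^bold>\<exists>a. rel f a b)))"

definition is_finite :: "var \<Rightarrow> form" where
  "is_finite A = (\<^bold>\<exists>n. \<^bold>\<exists>f. is_nat n \<^bold>\<and> is_bij f n A)"

section \<open>The axioms of ZF\<close>

definition Extensionality :: form where
  "Extensionality = (\<^bold>\<forall>x. \<^bold>\<forall>y. (\<^bold>\<forall>z. z \<^bold>\<in> x \<^bold>\<longleftrightarrow> z \<^bold>\<in> y) \<^bold>\<longrightarrow> x \<^bold>= y)"

definition Foundation :: form where
  "Foundation = (\<^bold>\<forall>x. (\<^bold>\<exists>y. y \<^bold>\<in> x) \<^bold>\<longrightarrow> (\<^bold>\<exists>y. y \<^bold>\<in> x \<^bold>\<and> \<^bold>\<not> (\<^bold>\<exists>z. z \<^bold>\<in> x \<^bold>\<and> z \<^bold>\<in> y)))"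

definition Pairing :: form where
  "Pairing = (\<^bold>\<forall>a. \<^bold>\<forall>b. \<^bold>\<exists>p. is_upair a b p)"

definition Union :: form where
  "Union = (\<^bold>\<forall>A. \<^bold>\<exists>U. \<^bold>\<forall>x. x \<^bold>\<in> U \<^bold>\<longleftrightarrow> (\<^bold>\<exists>y. y \<^bold>\<in> A \<^bold>\<and> x \<^bold>\<in> y))"

definition Powerset :: form where
  "Powerset = (\<^bold>\<forall>A. \<^bold>\<exists>U. \<^bold>\<forall>x. x \<^bold>\<in> U \<^bold>\<longleftrightarrow> x \<^bold>\<subseteq> A)"

definition Infinity :: form where
  "Infinity = (\<^bold>\<exists>w. is_inductive w)"

text \<open>
  For the schemas: \<open>param n P\<close> prefixes \<open>P\<close> with universal quantifiers for the parameters, which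
  get the levels \<open>0, \<dots>, n - 1\<close>, and \<open>sub \<phi> \<sigma>\<close> is \<open>\<phi>\<close> with the variable of level \<open>\<sigma> i\<close>
  put for the free index \<open>i\<close>.
\<close>

definition param :: "nat \<Rightarrow> form \<Rightarrow> form" where
  "param n P = (\<lambda>d. (Forall ^^ n) (P (d + n)))"

definition sub :: "fm \<Rightarrow> (nat \<Rightarrow> var) \<Rightarrow> form" where
  "sub \<phi> \<sigma> = (\<lambda>d. ren (\<lambda>i. d - Suc (\<sigma> i)) \<phi>)"

text \<open>
  Index 0 of \<open>\<phi>\<close> stands for \<open>x\<close>, and the indices \<open>1, \<dots>, n\<close> for the parameters.
\<close>

definition Separation :: "nat \<Rightarrow> fm \<Rightarrow> form" where
  "Separation n \<phi> = param n (\<^bold>\<forall>A. \<^bold>\<exists>B. \<^bold>\<forall>x. x \<^bold>\<in> B \<^bold>\<longleftrightarrow>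
     x \<^bold>\<in> A \<^bold>\<and> sub \<phi> (case_nat x (\<lambda>i. i)))"

text \<open>
  Indices 0 and 1 of \<open>\<phi>\<close> stand for \<open>x\<close> and \<open>y\<close>, and the indices \<open>2, \<dots>, n + 1\<close> for the parameters.
\<close>

definition Replacement :: "nat \<Rightarrow> fm \<Rightarrow> form" where
  "Replacement n \<phi> = param n (\<^bold>\<forall>A.
     (\<^bold>\<forall>x. x \<^bold>\<in> A \<^bold>\<longrightarrow> (\<^bold>\<forall>y. \<^bold>\<forall>z.
        sub \<phi> (case_nat x (case_nat y (\<lambda>i. i))) \<^bold>\<and> sub \<phi> (case_nat x (case_nat z (\<lambda>i. i)))
        \<^bold>\<longrightarrow> y \<^bold>= z)) \<^bold>\<longrightarrow>
     (\<^bold>\<exists>B. \<^bold>\<forall>y. y \<^bold>\<in> B \<^bold>\<longleftrightarrow>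
        (\<^bold>\<exists>x. x \<^bold>\<in> A \<^bold>\<and> sub \<phi> (case_nat x (case_nat y (\<lambda>i. i))))))"

definition ZF :: "fm set" where
  "ZF = {Extensionality 0, Foundation 0, Pairing 0, Union 0, Powerset 0, Infinity 0} \<union>
     {Separation n \<phi> 0 | n \<phi>. fv \<phi> \<subseteq> {..<n + 1}} \<union>
     {Replacement n \<phi> 0 | n \<phi>. fv \<phi> \<subseteq> {..<n + 2}}"

section \<open>The Boolean Prime Ideal theorem\<close>

text \<open>
  A term denotes a set, and is represented by the map that sends a property of sets to the formula
  saying that the denoted set has it.
\<close>

type_synonym trm = "(var \<Rightarrow> form) \<Rightarrow> form"

definition V :: "var \<Rightarrow> trm" where
  "V x = (\<lambda>k. k x)"

definition app1 :: "var \<Rightarrow> trm \<Rightarrow> trm" where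
  "app1 f s = (\<lambda>k. s (\<lambda>a. \<^bold>\<exists>c. rel f a c \<^bold>\<and> k c))"

definition app2 :: "var \<Rightarrow> trm \<Rightarrow> trm \<Rightarrow> trm" where
  "app2 f s t = (\<lambda>k. s (\<lambda>a. t (\<lambda>b. \<^bold>\<exists>p. is_pair a b p \<^bold>\<and> (\<^bold>\<exists>c. rel f p c \<^bold>\<and> k c))))"

definition teq :: "trm \<Rightarrow> trm \<Rightarrow> form" (infix "\<^bold>\<approx>" 55) where
  "s \<^bold>\<approx> t = s (\<lambda>a. t (\<lambda>b. a \<^bold>= b))"

definition tmem :: "trm \<Rightarrow> var \<Rightarrow> form" where
  "tmem s I = s (\<lambda>a. a \<^bold>\<in> I)"

text \<open>
  \<open>B\<close> is a Boolean algebra with join \<open>j\<close>, meet \<open>m\<close>, complement \<open>c\<close>, zero \<open>e\<close> and unit \<open>u\<close>.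
  The one-element algebra is allowed.
\<close>

definition is_boolean_algebra :: "var \<Rightarrow> var \<Rightarrow> var \<Rightarrow> var \<Rightarrow> var \<Rightarrow> var \<Rightarrow> form" where
  "is_boolean_algebra B j m c e u =
    ((\<^bold>\<exists>D. is_prod B B D \<^bold>\<and> is_fun j D B \<^bold>\<and> is_fun m D B) \<^bold>\<and>
     is_fun c B B \<^bold>\<and> e \<^bold>\<in> B \<^bold>\<and> u \<^bold>\<in> B \<^bold>\<and>
     (\<^bold>\<forall>x. x \<^bold>\<in> B \<^bold>\<longrightarrow> (\<^bold>\<forall>y. y \<^bold>\<in> B \<^bold>\<longrightarrow> (\<^bold>\<forall>z. z \<^bold>\<in> B \<^bold>\<longrightarrow>
       app2 j (V x) (V y) \<^bold>\<approx> app2 j (V y) (V x) \<^bold>\<and>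
       app2 m (V x) (V y) \<^bold>\<approx> app2 m (V y) (V x) \<^bold>\<and>
       app2 j (V x) (app2 j (V y) (V z)) \<^bold>\<approx> app2 j (app2 j (V x) (V y)) (V z) \<^bold>\<and>
       app2 m (V x) (app2 m (V y) (V z)) \<^bold>\<approx> app2 m (app2 m (V x) (V y)) (V z) \<^bold>\<and>
       app2 j (V x) (app2 m (V x) (V y)) \<^bold>\<approx> V x \<^bold>\<and>
       app2 m (V x) (app2 j (V x) (V y)) \<^bold>\<approx> V x \<^bold>\<and>
       app2 j (V x) (app2 m (V y) (V z))
         \<^bold>\<approx> app2 m (app2 j (V x) (V y)) (app2 j (V x) (V z)) \<^bold>\<and>
       app2 m (V x) (app2 j (V y) (V z))
         \<^bold>\<approx> app2 j (app2 m (V x) (V y)) (app2 m (V x) (V z)) \<^bold>\<and>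
       app2 j (V x) (app1 c (V x)) \<^bold>\<approx> V u \<^bold>\<and>
       app2 m (V x) (app1 c (V x)) \<^bold>\<approx> V e))))"

definition is_prime_ideal :: "var \<Rightarrow> var \<Rightarrow> var \<Rightarrow> var \<Rightarrow> var \<Rightarrow> var \<Rightarrow> form" where
  "is_prime_ideal I B j m e u =
    (I \<^bold>\<subseteq> B \<^bold>\<and> e \<^bold>\<in> I \<^bold>\<and> \<^bold>\<not> u \<^bold>\<in> I \<^bold>\<and>
     (\<^bold>\<forall>x. x \<^bold>\<in> I \<^bold>\<longrightarrow> (\<^bold>\<forall>y. y \<^bold>\<in> I \<^bold>\<longrightarrow> tmem (app2 j (V x) (V y)) I)) \<^bold>\<and>
     (\<^bold>\<forall>x. x \<^bold>\<in> I \<^bold>\<longrightarrow> (\<^bold>\<forall>y. y \<^bold>\<in> B \<^bold>\<longrightarrow> tmem (app2 m (V x) (V y)) I)) \<^bold>\<and>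
     (\<^bold>\<forall>x. x \<^bold>\<in> B \<^bold>\<longrightarrow> (\<^bold>\<forall>y. y \<^bold>\<in> B \<^bold>\<longrightarrow>
        tmem (app2 m (V x) (V y)) I \<^bold>\<longrightarrow> x \<^bold>\<in> I \<^bold>\<or> y \<^bold>\<in> I)))"

definition Boolean_Prime_Ideal :: form where
  "Boolean_Prime_Ideal =
    (\<^bold>\<forall>B. \<^bold>\<forall>j. \<^bold>\<forall>m. \<^bold>\<forall>c. \<^bold>\<forall>e. \<^bold>\<forall>u.
       is_boolean_algebra B j m c e u \<^bold>\<and> \<^bold>\<not> e \<^bold>= u \<^bold>\<longrightarrow> (\<^bold>\<exists>I. is_prime_ideal I B j m e u))"

section \<open>Generic 2-linked subsets of partial orders\<close>

text \<open>In the following, \<open>P\<close> is the underlying set and \<open>L\<close> the order relation of a partial order.\<close>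

definition is_partial_order :: "var \<Rightarrow> var \<Rightarrow> form" where
  "is_partial_order P L =
    (is_rel L P P \<^bold>\<and>
     (\<^bold>\<forall>p. p \<^bold>\<in> P \<^bold>\<longrightarrow> rel L p p) \<^bold>\<and>
     (\<^bold>\<forall>p. \<^bold>\<forall>q. rel L p q \<^bold>\<and> rel L q p \<^bold>\<longrightarrow> p \<^bold>= q) \<^bold>\<and>
     (\<^bold>\<forall>p. \<^bold>\<forall>q. \<^bold>\<forall>r. rel L p q \<^bold>\<and> rel L q r \<^bold>\<longrightarrow> rel L p r))"

definition compatible :: "var \<Rightarrow> var \<Rightarrow> var \<Rightarrow> var \<Rightarrow> form" where
  "compatible P L p q = (\<^bold>\<exists>r. r \<^bold>\<in> P \<^bold>\<and> rel L r p \<^bold>\<and> rel L r q)"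

definition is_antichain :: "var \<Rightarrow> var \<Rightarrow> var \<Rightarrow> form" where
  "is_antichain P L A = (A \<^bold>\<subseteq> P \<^bold>\<and>
     (\<^bold>\<forall>p. p \<^bold>\<in> A \<^bold>\<longrightarrow> (\<^bold>\<forall>q. q \<^bold>\<in> A \<^bold>\<longrightarrow> \<^bold>\<not> p \<^bold>= q \<^bold>\<longrightarrow> \<^bold>\<not> compatible P L p q)))"

definition is_2_linked :: "var \<Rightarrow> var \<Rightarrow> var \<Rightarrow> form" where
  "is_2_linked P L G = (G \<^bold>\<subseteq> P \<^bold>\<and>
     (\<^bold>\<forall>p. p \<^bold>\<in> G \<^bold>\<longrightarrow> (\<^bold>\<forall>q. q \<^bold>\<in> G \<^bold>\<longrightarrow> compatible P L p q)))"

text \<open>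
  A finite choice of antichains from \<open>F\<close> is a function \<open>s : n \<rightarrow> F\<close> on a natural number
  \<open>n = {0, \<dots>, n - 1} \<noteq> \<emptyset>\<close>; the elements chosen from them form a function \<open>t : n \<rightarrow> P\<close>.
\<close>

definition is_centred :: "var \<Rightarrow> var \<Rightarrow> var \<Rightarrow> form" where
  "is_centred P L F =
    (\<^bold>\<forall>n. \<^bold>\<forall>s. is_nat n \<^bold>\<and> \<^bold>\<not> is_empty n \<^bold>\<and> is_fun s n F \<^bold>\<longrightarrow>
       (\<^bold>\<exists>p. \<^bold>\<exists>t. p \<^bold>\<in> P \<^bold>\<and> is_fun t n P \<^bold>\<and>
         (\<^bold>\<forall>k. \<^bold>\<forall>A. \<^bold>\<forall>a. rel s k A \<^bold>\<and> rel t k a \<^bold>\<longrightarrow> a \<^bold>\<in> A \<^bold>\<and> rel L p a)))"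

definition is_generic :: "var \<Rightarrow> var \<Rightarrow> form" where
  "is_generic F G = (\<^bold>\<forall>A. A \<^bold>\<in> F \<^bold>\<longrightarrow> (\<^bold>\<exists>a. a \<^bold>\<in> G \<^bold>\<and> a \<^bold>\<in> A))"

definition Generic_2_Linked :: form where
  "Generic_2_Linked =
    (\<^bold>\<forall>P. \<^bold>\<forall>L. \<^bold>\<forall>F.
       is_partial_order P L \<^bold>\<and>
       (\<^bold>\<forall>A. A \<^bold>\<in> F \<^bold>\<longrightarrow> is_antichain P L A \<^bold>\<and> is_finite A) \<^bold>\<and>
       is_centred P L F \<^bold>\<longrightarrow>
       (\<^bold>\<exists>G. is_2_linked P L G \<^bold>\<and> is_generic F G))"

end

theory Submission
  imports Defs "HOL-Library.Countable_Set"
begin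

text \<open>
  By a Henkin construction it suffices to prove the equivalence in every model \<open>(M, \<epsilon>)\<close> of ZF; the
  argument inside a model uses only sets that exist in the model, and induction over its possibly
  nonstandard natural numbers only for definable predicates.

  A prime ideal from a generic set: for a Boolean algebra, take the poset of nonzero elements and
  the antichains \<open>{a \<and> b, a \<and> \<not> b, \<not> a} - {0}\<close>.  A 2-linked set that meets all of them is an
  ultrafilter.

  A generic set from a prime ideal: the sets \<open>{p. \<exists>a \<in> A. p \<le> a}\<close>, for \<open>A\<close> in the centred family,
  generate a proper filter on \<open>P\<close>.  A prime ideal of the power set of \<open>P\<close> modulo this filter yields an
  ultrafilter, and the set of those \<open>a\<close> whose cone \<open>{p. p \<le> a}\<close> is in the ultrafilter is 2-linked;
  it meets every \<open>A\<close> because \<open>A\<close> is finite.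
\<close>

section \<open>Completeness\<close>

text \<open>The choice operator of HOL stays outside the model: it may help to build the term model,
  but inside a model a subset exists only if Separation yields it from a definable predicate. So the
  constructions are accompanied by a proof of \<open>def_rel\<close> or \<open>def_fun\<close>,
  obtained from closure rules instead of by writing object-level formulas. The obstacle is to select
  and iterate without choice. For centredness, the elements taken from the given blocks must form a
  function of the model; since distinct elements of an antichain are incompatible, an element
  \<open>p\<close> below a member of every block determines these members, and the function is
  definable from \<open>p\<close>. In the other direction, finite sequences must be joined and
  finite unions of cones formed along sequences whose length is an internal natural number. Instead
  of an internal recursion, a definable statement about the first \<open>m\<close> entries is proved
  for all internal \<open>m\<close>.\<close>

lemma ren_cong: "(\<And>i. i \<in> fv p \<Longrightarrow> f i = g i) \<Longrightarrow> ren f p = ren g p"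
proof (induction p arbitrary: f g)
  case (Forall p)
  have "ren (case_nat 0 (\<lambda>i. Suc (f i))) p = ren (case_nat 0 (\<lambda>i. Suc (g i))) p"
    using Forall.prems by (intro Forall.IH) (auto split: nat.split)
  then show ?case by simp
next
  case (Imp p q)
  from Imp.IH(1)[of f g] Imp.IH(2)[of f g] Imp.prems show ?case by simp
qed simp_all

lemma ren_ren: "ren f (ren g p) = ren (f \<circ> g) p"
proof (induction p arbitrary: f g)
  case (Forall p)
  have "case_nat 0 (\<lambda>i. Suc (f i)) \<circ> case_nat 0 (\<lambda>i. Suc (g i)) = case_nat 0 (\<lambda>i. Suc ((f \<circ> g) i))"
    by (auto split: nat.split)
  then show ?case by (simp only: ren.simps Forall)
qed auto

lemma fv_ren: "fv (ren f p) = f ` fv p"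
proof (induction p arbitrary: f)
  case (Forall p)
  have "i \<in> f ` {i. Suc i \<in> fv p}" if "j \<in> fv p" "Suc i = case_nat 0 (\<lambda>i. Suc (f i)) j" for i j
    using that by (cases j) auto
  moreover have "Suc (f i) \<in> case_nat 0 (\<lambda>i. Suc (f i)) ` fv p" if "Suc i \<in> fv p" for i
    using that by (intro image_eqI[where x = "Suc i"]) auto
  ultimately have "{i. Suc i \<in> case_nat 0 (\<lambda>i. Suc (f i)) ` fv p} = f ` {i. Suc i \<in> fv p}" by blast
  then show ?case by (simp add: Forall.IH)
qed auto

lemma finite_fv: "finite (fv p)"
proof (induction p)
  case (Forall p)
  then have "finite (Suc -` fv p)" by (rule finite_vimageI) simp
  then show ?case by (simp add: vimage_def)
qed auto

lemma ren_id: "ren (\<lambda>i. i) p = p"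
proof (induction p)
  case (Forall p)
  have "case_nat 0 Suc = (\<lambda>i. i)" by (auto split: nat.split)
  with Forall show ?case by simp
qed auto

lemma inst_ren: "inst t (ren (case_nat 0 (\<lambda>i. Suc (f i))) p) = ren (case_nat t f) p"
proof -
  have "case_nat t (\<lambda>i. i) \<circ> case_nat 0 (\<lambda>i. Suc (f i)) = case_nat t f"
    by (rule ext) (simp split: nat.split)
  then show ?thesis by (simp only: inst_def ren_ren)
qed

lemma ren_inst: "ren f (inst t p) = inst (f t) (ren (case_nat 0 (\<lambda>i. Suc (f i))) p)"
proof -
  have "f \<circ> case_nat t (\<lambda>i. i) = case_nat (f t) f"
    by (rule ext) (simp split: nat.split)
  then show ?thesis by (simp only: inst_ren) (simp only: inst_def ren_ren)
qed

section \<open>Structural properties of the deduction system\<close>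

lemma proves_mono: "\<Gamma> \<turnstile> p \<Longrightarrow> \<Gamma> \<subseteq> \<Delta> \<Longrightarrow> \<Delta> \<turnstile> p"
proof (induction arbitrary: \<Delta> rule: proves.induct)
  case (Assm p \<Gamma>)
  then show ?case by (blast intro: proves.Assm)
next
  case (ImpI p \<Gamma> q)
  from ImpI.IH[OF insert_mono[OF ImpI.prems]] show ?case by (rule proves.ImpI)
next
  case (ImpE \<Gamma> p q)
  from ImpE.IH[OF ImpE.prems] show ?case by (rule proves.ImpE)
next
  case (Contr p \<Gamma>)
  from Contr.IH[OF insert_mono[OF Contr.prems]] show ?case by (rule proves.Contr)
next
  case (AllI \<Gamma> p)
  from AllI.IH[OF image_mono[OF AllI.prems]] show ?case by (rule proves.AllI)
next
  case (AllE \<Gamma> p t)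
  from AllE.IH[OF AllE.prems] show ?case by (rule proves.AllE)
next
  case (EqlI \<Gamma> t)
  show ?case by (rule proves.EqlI)
next
  case (EqlE \<Gamma> s t p)
  from EqlE.IH[OF EqlE.prems] show ?case by (rule proves.EqlE)
qed

lemma proves_ren: "\<Gamma> \<turnstile> p \<Longrightarrow> ren f ` \<Gamma> \<turnstile> ren f p"
proof (induction arbitrary: f rule: proves.induct)
  case (AllI \<Gamma> p)
  let ?g = "case_nat 0 (\<lambda>i. Suc (f i))"
  have "ren ?g ` ren Suc ` \<Gamma> = ren Suc ` ren f ` \<Gamma>"
    unfolding image_image ren_ren by (intro image_cong ren_cong) auto
  with AllI.IH[of ?g] have "ren Suc ` ren f ` \<Gamma> \<turnstile> ren ?g p" by (simp only:)
  then show ?case unfolding ren.simps by (rule proves.AllI)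
next
  case (Assm p \<Gamma>)
  then show ?case by (intro proves.Assm imageI)
next
  case (ImpI p \<Gamma> q)
  from ImpI.IH[of f] show ?case unfolding image_insert ren.simps by (rule proves.ImpI)
next
  case (ImpE \<Gamma> p q)
  from ImpE.IH[of f] show ?case unfolding ren.simps by (rule proves.ImpE)
next
  case (Contr p \<Gamma>)
  from Contr.IH[of f] show ?case unfolding image_insert ren.simps by (rule proves.Contr)
next
  case (AllE \<Gamma> p t)
  from AllE.IH[of f] show ?case unfolding ren.simps ren_inst by (rule proves.AllE)
next
  case (EqlI \<Gamma> t)
  show ?case unfolding ren.simps by (rule proves.EqlI)
next
  case (EqlE \<Gamma> s t p)
  from EqlE.IH(1)[of f] EqlE.IH(2)[of f] show ?case
    unfolding ren.simps ren_inst by (rule proves.EqlE)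
qed

text \<open>Compactness: a derivation uses finitely many assumptions, so an inconsistency of the
  union of a chain already shows at one of its stages.\<close>

lemma proves_finite: "\<Gamma> \<turnstile> p \<Longrightarrow> \<exists>\<Delta>. finite \<Delta> \<and> \<Delta> \<subseteq> \<Gamma> \<and> \<Delta> \<turnstile> p"
proof (induction rule: proves.induct)
  case (Assm p \<Gamma>)
  then have "finite {p} \<and> {p} \<subseteq> \<Gamma> \<and> {p} \<turnstile> p" by (simp add: proves.Assm)
  then show ?case by (rule exI)
next
  case (ImpI p \<Gamma> q)
  then obtain \<Delta> where \<Delta>: "finite \<Delta>" "\<Delta> \<subseteq> insert p \<Gamma>" "\<Delta> \<turnstile> q" by blast
  have "insert p (\<Delta> - {p}) \<turnstile> q" by (rule proves_mono[OF \<Delta>(3)]) blast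
  then have "\<Delta> - {p} \<turnstile> Imp p q" by (rule proves.ImpI)
  moreover have "finite (\<Delta> - {p})" "\<Delta> - {p} \<subseteq> \<Gamma>" using \<Delta> by auto
  ultimately show ?case by metis
next
  case (ImpE \<Gamma> p q)
  then obtain \<Delta> \<Delta>' where \<Delta>: "finite \<Delta>" "\<Delta> \<subseteq> \<Gamma>" "\<Delta> \<turnstile> Imp p q" "finite \<Delta>'" "\<Delta>' \<subseteq> \<Gamma>" "\<Delta>' \<turnstile> p"
    by blast
  have "\<Delta> \<union> \<Delta>' \<turnstile> q"
    using proves_mono[OF \<Delta>(3)] proves_mono[OF \<Delta>(6)] by (rule proves.ImpE) auto
  moreover have "finite (\<Delta> \<union> \<Delta>')" "\<Delta> \<union> \<Delta>' \<subseteq> \<Gamma>" using \<Delta> by auto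
  ultimately show ?case by metis
next
  case (Contr p \<Gamma>)
  let ?n = "Imp p Falsum"
  from Contr obtain \<Delta> where \<Delta>: "finite \<Delta>" "\<Delta> \<subseteq> insert ?n \<Gamma>" "\<Delta> \<turnstile> Falsum" by blast
  have "insert ?n (\<Delta> - {?n}) \<turnstile> Falsum" by (rule proves_mono[OF \<Delta>(3)]) blast
  then have "\<Delta> - {?n} \<turnstile> p" by (rule proves.Contr)
  moreover have "finite (\<Delta> - {?n})" "\<Delta> - {?n} \<subseteq> \<Gamma>" using \<Delta> by auto
  ultimately show ?case by metis
next
  case (AllI \<Gamma> p)
  then obtain \<Delta> where \<Delta>: "finite \<Delta>" "\<Delta> \<subseteq> ren Suc ` \<Gamma>" "\<Delta> \<turnstile> p" by blast
  then obtain \<Delta>' where "\<Delta>' \<subseteq> \<Gamma>" "finite \<Delta>'" "\<Delta> = ren Suc ` \<Delta>'"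
    using finite_subset_image by meson
  with proves.AllI[of \<Delta>' p] \<Delta>(3) show ?case by metis
next
  case (AllE \<Gamma> p t)
  then obtain \<Delta> where \<Delta>: "finite \<Delta>" "\<Delta> \<subseteq> \<Gamma>" "\<Delta> \<turnstile> Forall p" by blast
  with proves.AllE[OF \<Delta>(3), of t] show ?case by metis
next
  case (EqlI \<Gamma> t)
  have "finite {} \<and> {} \<subseteq> \<Gamma> \<and> {} \<turnstile> Eql t t" by (simp add: proves.EqlI)
  then show ?case by (rule exI)
next
  case (EqlE \<Gamma> s t p)
  then obtain \<Delta> \<Delta>' where \<Delta>: "finite \<Delta>" "\<Delta> \<subseteq> \<Gamma>" "\<Delta> \<turnstile> Eql s t" "finite \<Delta>'" "\<Delta>' \<subseteq> \<Gamma>" "\<Delta>' \<turnstile> inst s p"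
    by blast
  have "\<Delta> \<union> \<Delta>' \<turnstile> inst t p"
    using proves_mono[OF \<Delta>(3)] proves_mono[OF \<Delta>(6)] by (rule proves.EqlE) auto
  moreover have "finite (\<Delta> \<union> \<Delta>')" "\<Delta> \<union> \<Delta>' \<subseteq> \<Gamma>" using \<Delta> by auto
  ultimately show ?case by metis
qed

text \<open>A variable \<open>c\<close> that occurs neither in the assumptions nor in the body can
  act as eigenvariable: the renaming that sends \<open>c\<close> to 0 and raises every other index
  turns \<open>inst c p\<close> back into \<open>p\<close> and the assumptions into their shift,
  which is the premise of \<open>AllI\<close>.\<close>

lemma proves_generalize:
  assumes "\<Gamma> \<turnstile> inst c p" and "\<And>q. q \<in> \<Gamma> \<Longrightarrow> c \<notin> fv q" and "Suc c \<notin> fv p"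
  shows "\<Gamma> \<turnstile> Forall p"
proof -
  let ?f = "\<lambda>i. if i = c then 0 else Suc i"
  have "ren ?f (inst c p) = ren (\<lambda>i. i) p"
    unfolding inst_def ren_ren using assms(3) by (intro ren_cong) (auto split: nat.split)
  then have "ren ?f (inst c p) = p" by (simp only: ren_id)
  moreover have "ren ?f ` \<Gamma> = ren Suc ` \<Gamma>"
    using assms(2) by (intro image_cong ren_cong) auto
  ultimately show ?thesis using proves_ren[OF assms(1), of ?f] by (simp add: proves.AllI)
qed

lemma proves_cut: "\<Gamma> \<turnstile> p \<Longrightarrow> insert p \<Gamma> \<turnstile> q \<Longrightarrow> \<Gamma> \<turnstile> q"
  by (rule proves.ImpE[OF proves.ImpI])

section \<open>The Henkin construction\<close>

instance fm :: countable by countable_datatype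

definition consistent :: "fm set \<Rightarrow> bool" where
  "consistent \<Gamma> \<longleftrightarrow> \<not> \<Gamma> \<turnstile> Falsum"

definition fresh :: "fm set \<Rightarrow> nat" where
  "fresh \<Gamma> = (SOME c. \<forall>q \<in> \<Gamma>. c \<notin> fv q)"

definition henkin_step :: "fm set \<Rightarrow> fm \<Rightarrow> fm set" where
  "henkin_step \<Gamma> p =
    (if consistent (insert p \<Gamma>)
     then insert p \<Gamma> \<union>
       {Imp (inst (fresh (insert p \<Gamma>)) q) Falsum | q. p = Imp (Forall q) Falsum}
     else \<Gamma>)"

primrec henkin_chain :: "fm set \<Rightarrow> nat \<Rightarrow> fm set" where
  "henkin_chain \<Gamma> 0 = \<Gamma>"
| "henkin_chain \<Gamma> (Suc n) = henkin_step (henkin_chain \<Gamma> n) (from_nat n)"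

definition fin_fv :: "fm set \<Rightarrow> bool" where
  "fin_fv \<Gamma> \<longleftrightarrow> finite (\<Union>q \<in> \<Gamma>. fv q)"

lemma fin_fv_insert [simp]: "fin_fv (insert p \<Gamma>) \<longleftrightarrow> fin_fv \<Gamma>"
  by (simp add: fin_fv_def finite_fv)

lemma fresh:
  assumes "fin_fv \<Gamma>" "q \<in> \<Gamma>"
  shows "fresh \<Gamma> \<notin> fv q"
proof -
  obtain c where "c \<notin> (\<Union>q \<in> \<Gamma>. fv q)"
    using assms(1) ex_new_if_finite[OF infinite_UNIV_nat] unfolding fin_fv_def by blast
  then have "\<forall>q \<in> \<Gamma>. c \<notin> fv q" by blast
  then have "\<forall>q \<in> \<Gamma>. fresh \<Gamma> \<notin> fv q" unfolding fresh_def by (rule someI)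
  with assms(2) show ?thesis by blast
qed

text \<open>Refuting the witness would, by \<open>Contr\<close>, prove the instance at a variable
  absent from \<Gamma>, hence the universal formula whose negation lies in \<Gamma>.\<close>

lemma consistent_witness:
  assumes "consistent \<Gamma>" "Imp (Forall q) Falsum \<in> \<Gamma>" "fin_fv \<Gamma>"
  shows "consistent (insert (Imp (inst (fresh \<Gamma>) q) Falsum) \<Gamma>)"
  unfolding consistent_def
proof
  assume "insert (Imp (inst (fresh \<Gamma>) q) Falsum) \<Gamma> \<turnstile> Falsum"
  then have "\<Gamma> \<turnstile> inst (fresh \<Gamma>) q" by (rule proves.Contr)
  moreover have "Suc (fresh \<Gamma>) \<notin> fv q" using fresh[OF assms(3,2)] by simp
  ultimately have "\<Gamma> \<turnstile> Forall q" using fresh[OF assms(3)] by (intro proves_generalize) auto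
  with proves.Assm[OF assms(2)] have "\<Gamma> \<turnstile> Falsum" by (rule proves.ImpE)
  then show False using assms(1) by (simp add: consistent_def)
qed

lemma henkin_step:
  assumes "consistent \<Gamma>" "fin_fv \<Gamma>"
  shows "consistent (henkin_step \<Gamma> p)" "fin_fv (henkin_step \<Gamma> p)"
proof -
  have "consistent (henkin_step \<Gamma> p) \<and> fin_fv (henkin_step \<Gamma> p)"
  proof (cases "consistent (insert p \<Gamma>) \<and> (\<exists>q. p = Imp (Forall q) Falsum)")
    case True
    then obtain q where q: "p = Imp (Forall q) Falsum" by blast
    have "henkin_step \<Gamma> p = insert (Imp (inst (fresh (insert p \<Gamma>)) q) Falsum) (insert p \<Gamma>)"
      using True q by (auto simp: henkin_step_def)
    with True q assms show ?thesis
      by (simp add: consistent_witness)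
  next
    case False
    then have "henkin_step \<Gamma> p = insert p \<Gamma> \<and> consistent (insert p \<Gamma>) \<or> henkin_step \<Gamma> p = \<Gamma>"
      by (auto simp: henkin_step_def)
    with assms show ?thesis by auto
  qed
  then show "consistent (henkin_step \<Gamma> p)" "fin_fv (henkin_step \<Gamma> p)" by auto
qed

lemma henkin_chain:
  assumes "consistent \<Gamma>" "fin_fv \<Gamma>"
  shows "consistent (henkin_chain \<Gamma> n)" "fin_fv (henkin_chain \<Gamma> n)"
  using assms by (induction n) (auto intro: henkin_step)

lemma henkin_chain_mono: "m \<le> n \<Longrightarrow> henkin_chain \<Gamma> m \<subseteq> henkin_chain \<Gamma> n"
proof (rule lift_Suc_mono_le)
  show "henkin_chain \<Gamma> n \<subseteq> henkin_chain \<Gamma> (Suc n)" for n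
    by (auto simp: henkin_step_def)
qed

locale henkin =
  fixes H :: "fm set"
  assumes closed: "H \<turnstile> p \<Longrightarrow> p \<in> H"
    and Falsum: "Falsum \<notin> H"
    and complete: "p \<notin> H \<Longrightarrow> Imp p Falsum \<in> H"
    and witness: "Imp (Forall p) Falsum \<in> H \<Longrightarrow> \<exists>t. Imp (inst t p) Falsum \<in> H"
begin

lemma mp: "Imp p q \<in> H \<Longrightarrow> p \<in> H \<Longrightarrow> q \<in> H"
  by (rule closed[OF proves.ImpE[OF proves.Assm proves.Assm]])

lemma Imp_iff: "Imp p q \<in> H \<longleftrightarrow> (p \<in> H \<longrightarrow> q \<in> H)"
proof
  assume *: "p \<in> H \<longrightarrow> q \<in> H"
  show "Imp p q \<in> H"
  proof (cases "p \<in> H")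
    case True
    with * have "insert p H \<turnstile> q" by (simp add: proves.Assm)
    then show ?thesis by (rule closed[OF proves.ImpI])
  next
    case False
    then have "Imp p Falsum \<in> H" by (rule complete)
    then have "insert (Imp q Falsum) (insert p H) \<turnstile> Falsum"
      by (intro proves.ImpE[OF proves.Assm[of "Imp p Falsum"] proves.Assm]) auto
    from closed[OF proves.ImpI[OF proves.Contr[OF this]]] show ?thesis .
  qed
qed (blast intro: mp)

lemma Forall_iff: "Forall p \<in> H \<longleftrightarrow> (\<forall>t. inst t p \<in> H)"
proof
  show "\<forall>t. inst t p \<in> H" if "Forall p \<in> H"
    using closed[OF proves.AllE[OF proves.Assm[OF that]]] by blast
  show "Forall p \<in> H" if *: "\<forall>t. inst t p \<in> H"
  proof (rule ccontr)
    assume "Forall p \<notin> H"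
    then obtain t where "Imp (inst t p) Falsum \<in> H" using complete witness by blast
    with * show False using mp Falsum by blast
  qed
qed

lemma Eql_subst: "Eql s t \<in> H \<Longrightarrow> inst s p \<in> H \<Longrightarrow> inst t p \<in> H"
  by (rule closed[OF proves.EqlE[OF proves.Assm proves.Assm]])

lemma Eql_refl: "Eql t t \<in> H"
  by (rule closed[OF proves.EqlI])

lemma Eql_sym: "Eql s t \<in> H \<Longrightarrow> Eql t s \<in> H"
  \<comment> \<open>The substituted formula is \<open>x = s\<close> with \<open>x\<close> at index 0
    and \<open>s\<close> shifted past it: at \<open>s\<close> it is reflexivity, at \<open>t\<close>
    the goal.\<close>
  using Eql_subst[of s t "Eql 0 (Suc s)"] by (simp add: inst_def Eql_refl)

lemma Eql_trans: "Eql s t \<in> H \<Longrightarrow> Eql t r \<in> H \<Longrightarrow> Eql s r \<in> H"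
  using Eql_subst[of t r "Eql (Suc s) 0"] by (simp add: inst_def)

lemma Mem_left: "Eql s t \<in> H \<Longrightarrow> Mem s r \<in> H \<Longrightarrow> Mem t r \<in> H"
  using Eql_subst[of s t "Mem 0 (Suc r)"] by (simp add: inst_def)

lemma Mem_right: "Eql s t \<in> H \<Longrightarrow> Mem r s \<in> H \<Longrightarrow> Mem r t \<in> H"
  using Eql_subst[of s t "Mem (Suc r) 0"] by (simp add: inst_def)

lemma Eql_class: "{k. Eql i k \<in> H} = {k. Eql j k \<in> H} \<longleftrightarrow> Eql i j \<in> H"
  using Eql_refl Eql_sym Eql_trans by blast

end

lemma henkin_extension:
  assumes "consistent \<Gamma>" "fin_fv \<Gamma>"
  shows "\<exists>H. \<Gamma> \<subseteq> H \<and> henkin H"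
proof -
  define C where "C = henkin_chain \<Gamma>"
  define H where "H = (\<Union>n. C n)"
  have mono: "C m \<subseteq> C n" if "m \<le> n" for m n
    using henkin_chain_mono[OF that] by (simp add: C_def)
  have C: "consistent (C n)" "fin_fv (C n)" for n
    using henkin_chain[OF assms] by (auto simp: C_def)
  have H: "consistent H" unfolding consistent_def
  proof
    assume "H \<turnstile> Falsum"
    then obtain \<Delta> where \<Delta>: "finite \<Delta>" "\<Delta> \<subseteq> H" "\<Delta> \<turnstile> Falsum" using proves_finite by blast
    from \<Delta>(1,2) have "\<exists>n. \<Delta> \<subseteq> C n"
    proof (induction)
      case (insert p \<Delta>)
      then obtain n m where "\<Delta> \<subseteq> C n" "p \<in> C m" by (auto simp: H_def)
      then have "insert p \<Delta> \<subseteq> C (max n m)" using mono[of n "max n m"] mono[of m "max n m"] by auto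
      then show ?case by blast
    qed auto
    then obtain n where "\<Delta> \<subseteq> C n" by blast
    from proves_mono[OF \<Delta>(3) this] C(1)[of n] show False by (simp add: consistent_def)
  qed
  \<comment> \<open>Every formula has a number \<open>n\<close> in the enumeration; if it is
    consistent with the limit, it is consistent with stage \<open>n\<close> and was added there,
    together with its witness.\<close>
  have add: "p \<in> H \<and> (\<forall>q. p = Imp (Forall q) Falsum \<longrightarrow> (\<exists>t. Imp (inst t q) Falsum \<in> H))"
    if "consistent (insert p H)" for p
  proof -
    obtain n where n: "p = from_nat n" by (metis from_nat_to_nat)
    have "consistent (insert p (C n))"
      using that proves_mono[of "insert p (C n)" Falsum "insert p H"] unfolding consistent_def H_def by blast
    then have "p \<in> C (Suc n)"
      "\<forall>q. p = Imp (Forall q) Falsum \<longrightarrow> (\<exists>t. Imp (inst t q) Falsum \<in> C (Suc n))"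
      by (auto simp: C_def henkin_step_def n)
    then show ?thesis unfolding H_def by blast
  qed
  have "henkin H"
  proof
    show "p \<in> H" if "H \<turnstile> p" for p
      using add[of p] proves_cut[OF that] H unfolding consistent_def by blast
    show "Falsum \<notin> H" using H proves.Assm unfolding consistent_def by blast
    show "Imp p Falsum \<in> H" if "p \<notin> H" for p
    proof -
      have "H \<turnstile> Imp p Falsum" using that add[of p] proves.ImpI by (auto simp: consistent_def)
      then show ?thesis
        using add[of "Imp p Falsum"] proves_cut H unfolding consistent_def by blast
    qed
    show "\<exists>t. Imp (inst t p) Falsum \<in> H" if "Imp (Forall p) Falsum \<in> H" for p
      using add[of "Imp (Forall p) Falsum"] H that by (simp add: insert_absorb)
  qed
  moreover have "\<Gamma> \<subseteq> H" unfolding H_def C_def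
    by (metis UN_upper UNIV_I henkin_chain.simps(1))
  ultimately show ?thesis by blast
qed

section \<open>Satisfaction, the term model and completeness\<close>

primrec sat :: "('a \<Rightarrow> 'a \<Rightarrow> bool) \<Rightarrow> (nat \<Rightarrow> 'a) \<Rightarrow> fm \<Rightarrow> bool" where
  "sat E v (Mem i j) = E (v i) (v j)"
| "sat E v (Eql i j) = (v i = v j)"
| "sat E v Falsum = False"
| "sat E v (Imp p q) = (sat E v p \<longrightarrow> sat E v q)"
| "sat E v (Forall p) = (\<forall>a. sat E (case_nat a v) p)"

lemma sat_cong: "(\<And>i. i \<in> fv p \<Longrightarrow> v i = w i) \<Longrightarrow> sat E v p = sat E w p"
proof (induction p arbitrary: v w)
  case (Forall p)
  have "sat E (case_nat a v) p = sat E (case_nat a w) p" for a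
    using Forall.prems by (intro Forall.IH) (auto split: nat.split)
  then show ?case by simp
next
  case (Imp p q)
  from Imp.IH(1)[of v w] Imp.IH(2)[of v w] Imp.prems show ?case by simp
qed auto

lemma sat_ren: "sat E v (ren f p) = sat E (v \<circ> f) p"
proof (induction p arbitrary: v f)
  case (Forall p)
  have "case_nat a v \<circ> case_nat 0 (\<lambda>i. Suc (f i)) = case_nat a (v \<circ> f)" for a
    by (auto split: nat.split)
  then show ?case by (simp only: ren.simps sat.simps Forall.IH)
qed auto

text \<open>The renaming \<open>f\<close> is arbitrary because the quantifier step instantiates the
  bound variable, which \<open>inst_ren\<close> turns into the renaming \<open>case_nat t f\<close>.
  Surjectivity of \<open>h\<close> means that every element is named by a variable, so instances at
  variables decide a universal formula.\<close>

lemma (in henkin) truth: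
  assumes "surj h" "\<And>i j. h i = h j \<longleftrightarrow> Eql i j \<in> H" "\<And>i j. E (h i) (h j) \<longleftrightarrow> Mem i j \<in> H"
  shows "sat E (h \<circ> f) p \<longleftrightarrow> ren f p \<in> H"
proof (induction p arbitrary: f)
  case (Forall p)
  have "case_nat (h t) (h \<circ> f) = h \<circ> case_nat t f" for t by (auto split: nat.split)
  then have "(\<forall>t. sat E (case_nat (h t) (h \<circ> f)) p) \<longleftrightarrow> Forall (ren (case_nat 0 (\<lambda>i. Suc (f i))) p) \<in> H"
    by (simp add: Forall.IH Forall_iff inst_ren)
  then show ?case using surjD[OF assms(1)] by (metis sat.simps(5) ren.simps(5))
qed (use assms Falsum in \<open>auto simp: Imp_iff\<close>)

lemmas form_defs = fmem_def feql_def ffalse_def fimp_def fall_def fneg_def fconj_def fdisj_def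
  fiff_def fex_def

text \<open>Singletons and the empty set make the quotient by provable equality infinite, so that the model
  can be carried by the whole type of natural numbers and equality is interpreted as equality.\<close>

lemma (in henkin) infinite_quotient:
  assumes "ZF \<subseteq> H"
  shows "infinite (range (\<lambda>i. {j. Eql i j \<in> H}))"
proof
  let ?h = "\<lambda>i. {j. Eql i j \<in> H}"
  note h = Eql_class
  assume fin: "finite (range ?h)"
  have "Pairing 0 \<in> H" "Infinity 0 \<in> H" using assms by (auto simp: ZF_def)
  note iffs = form_defs Imp_iff Forall_iff inst_def Falsum
  from \<open>Pairing 0 \<in> H\<close>
  have "\<forall>a b. \<exists>p. \<forall>z. Mem z p \<in> H \<longleftrightarrow> Eql z a \<in> H \<or> Eql z b \<in> H"
    by (simp add: Pairing_def is_upair_def iffs numeral_2_eq_2 numeral_3_eq_3) blast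
  then have "\<forall>x. \<exists>p. \<forall>z. Mem z p \<in> H \<longleftrightarrow> Eql z x \<in> H" by blast
  then obtain s where s: "Mem z (s x) \<in> H \<longleftrightarrow> Eql z x \<in> H" for x z by metis
  from \<open>Infinity 0 \<in> H\<close> obtain e where e: "Mem z e \<notin> H" for z
    by (simp add: Infinity_def is_inductive_def is_empty_def iffs) blast
  \<comment> \<open>On classes of equal variables, \<open>g\<close> is the singleton map. It is
    injective and misses the class of the empty set, which is impossible for a self-map of a finite
    set.\<close>
  define g where "g X = ?h (s (SOME x. ?h x = X))" for X
  have g: "\<exists>x. X = ?h x \<and> g X = ?h (s x)" if "X \<in> range ?h" for X
  proof -
    from that have "\<exists>x. ?h x = X" by blast
    then have "?h (SOME x. ?h x = X) = X" by (rule someI_ex)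
    then show ?thesis unfolding g_def by metis
  qed
  have "inj_on g (range ?h)"
  proof (rule inj_onI)
    fix X Y assume "X \<in> range ?h" "Y \<in> range ?h" and eq: "g X = g Y"
    then obtain x y where x: "X = ?h x" "g X = ?h (s x)" and y: "Y = ?h y" "g Y = ?h (s y)"
      using g by meson
    from eq x(2) y(2) h[of "s x" "s y"] have "Eql (s x) (s y) \<in> H" by simp
    then have "Mem x (s y) \<in> H" using Mem_right s Eql_refl by blast
    then have "Eql x y \<in> H" using s by simp
    with h[of x y] x(1) y(1) show "X = Y" by simp
  qed
  moreover have "g ` range ?h \<subseteq> range ?h" using g by blast
  ultimately have "g ` range ?h = range ?h" using fin by (simp add: endo_inj_surj)
  then have "?h e \<in> g ` range ?h" by simp
  then obtain X where X: "X \<in> range ?h" "?h e = g X" by blast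
  from g[OF X(1)] X(2) obtain x where "?h e = ?h (s x)" by auto
  then have "Eql (s x) e \<in> H" using h by blast
  then show False using Mem_right s e Eql_refl by blast
qed

text \<open>A premise in HOL cannot quantify over carrier types, so completeness needs one fixed
  carrier. The classes of variables equal according to \<open>H\<close> are infinite in number,
  hence can be numbered bijectively by \<open>nat\<close>.\<close>

lemma henkin_model:
  assumes "ZF \<subseteq> \<Gamma>" "consistent \<Gamma>" "fin_fv \<Gamma>"
  shows "\<exists>(E :: nat \<Rightarrow> nat \<Rightarrow> bool) v. \<forall>p \<in> \<Gamma>. sat E v p"
proof -
  from henkin_extension[OF assms(2,3)] obtain H where H: "\<Gamma> \<subseteq> H" "henkin H" by blast
  interpret henkin H by (rule H(2))
  let ?h = "\<lambda>i. {j. Eql i j \<in> H}"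
  have "infinite (range ?h)" by (rule infinite_quotient[OF subset_trans[OF assms(1) H(1)]])
  then have bij: "bij_betw (to_nat_on (range ?h)) (range ?h) UNIV"
    by (rule to_nat_on_infinite[OF countable_image[OF countableI_type]])
  define h where "h i = to_nat_on (range ?h) (?h i)" for i
  have "range h = to_nat_on (range ?h) ` range ?h" unfolding h_def by (simp only: image_image)
  then have "surj h" using bij by (simp only: bij_betw_def)
  have h: "h i = h j \<longleftrightarrow> Eql i j \<in> H" for i j
    unfolding h_def by (rule trans[OF inj_on_eq_iff[OF bij_betw_imp_inj_on[OF bij] rangeI rangeI] Eql_class])
  define E where "E a b \<longleftrightarrow> (\<exists>i j. a = h i \<and> b = h j \<and> Mem i j \<in> H)" for a b
  have E: "E (h i) (h j) \<longleftrightarrow> Mem i j \<in> H" for i j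
  proof
    assume "E (h i) (h j)"
    then obtain k l where kl: "h i = h k" "h j = h l" and mem: "Mem k l \<in> H"
      unfolding E_def by blast
    then have "Eql k i \<in> H" "Eql l j \<in> H" by (simp_all add: h[symmetric])
    from Mem_left[OF this(1) Mem_right[OF this(2) mem]] show "Mem i j \<in> H" .
  next
    assume "Mem i j \<in> H"
    then show "E (h i) (h j)" unfolding E_def by blast
  qed
  have "sat E (h \<circ> (\<lambda>i. i)) p \<longleftrightarrow> p \<in> H" for p
    using truth[OF \<open>surj h\<close> h E, of "\<lambda>i. i" p] by (simp only: ren_id)
  with H(1) have "\<forall>p \<in> \<Gamma>. sat E (h \<circ> (\<lambda>i. i)) p" by blast
  then show ?thesis by (intro exI)
qed

lemma fv_Forall_pow: "fv ((Forall ^^ n) p) = {i. i + n \<in> fv p}"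
  by (induction n) auto

lemma fv_Separation:
  assumes "fv \<phi> \<subseteq> {..<n + 1}"
  shows "fv (Separation n \<phi> 0) = {}"
  using assms
  by (force simp: Separation_def param_def sub_def form_defs fv_Forall_pow fv_ren subset_iff split: nat.splits)

lemma fv_Replacement:
  assumes "fv \<phi> \<subseteq> {..<n + 2}"
  shows "fv (Replacement n \<phi> 0) = {}"
  using assms
  by (force simp: Replacement_def param_def sub_def form_defs fv_Forall_pow fv_ren subset_iff split: nat.splits)

text \<open>The infinitely many schema instances are sentences and contribute no variable, so only
  the six single axioms have to be bounded. This starts the Henkin construction with an unlimited
  supply of witnesses.\<close>

lemma fin_fv_ZF: "fin_fv ZF"
proof -
  let ?S = "{Extensionality 0, Foundation 0, Pairing 0, Union 0, Powerset 0, Infinity 0}"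
  have "(\<Union>q \<in> ZF. fv q) \<subseteq> (\<Union>q \<in> ?S. fv q)"
    by (auto simp: ZF_def fv_Separation fv_Replacement simp del: fv.simps)
  then show ?thesis unfolding fin_fv_def by (rule finite_subset) (simp add: finite_fv)
qed

theorem ZF_complete:
  assumes "\<And>(E :: nat \<Rightarrow> nat \<Rightarrow> bool) v. (\<And>q. q \<in> ZF \<Longrightarrow> sat E v q) \<Longrightarrow> sat E v p"
  shows "ZF \<turnstile> p"
proof (rule ccontr)
  assume "\<not> ZF \<turnstile> p"
  then have "consistent (insert (Imp p Falsum) ZF)"
    unfolding consistent_def using proves.Contr[of p ZF] by blast
  then have "\<exists>(E :: nat \<Rightarrow> nat \<Rightarrow> bool) v. \<forall>q \<in> insert (Imp p Falsum) ZF. sat E v q"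
    by (rule henkin_model[OF subset_insertI]) (simp add: fin_fv_ZF)
  then obtain E :: "nat \<Rightarrow> nat \<Rightarrow> bool" and v
    where "sat E v (Imp p Falsum)" and "\<And>q. q \<in> ZF \<Longrightarrow> sat E v q" by blast
  with assms[of E v] show False by simp
qed

section \<open>Semantics of level formulas\<close>

text \<open>Below \<open>d\<close> quantifiers, \<open>e\<close> assigns values to the levels \<open>0, \<dots>, d - 1\<close>, and \<open>c\<close> to the
  indices that remain free.\<close>

definition env :: "(nat \<Rightarrow> 'a) \<Rightarrow> nat \<Rightarrow> (var \<Rightarrow> 'a) \<Rightarrow> nat \<Rightarrow> 'a" where
  "env c d e = (\<lambda>i. if i < d then e (d - Suc i) else c (i - d))"

definition sem :: "('a \<Rightarrow> 'a \<Rightarrow> bool) \<Rightarrow> (nat \<Rightarrow> 'a) \<Rightarrow> nat \<Rightarrow> (var \<Rightarrow> 'a) \<Rightarrow> form \<Rightarrow> bool" where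
  "sem E c d e P = sat E (env c d e) (P d)"

lemma env_upd: "case_nat a (env c d e) = env c (Suc d) (e(d := a))"
  by (rule ext) (auto simp: env_def split: nat.split)

lemma sem_mem [simp]: "x < d \<Longrightarrow> y < d \<Longrightarrow> sem E c d e (x \<^bold>\<in> y) \<longleftrightarrow> E (e x) (e y)"
  by (simp add: sem_def fmem_def env_def)

lemma sem_eql [simp]: "x < d \<Longrightarrow> y < d \<Longrightarrow> sem E c d e (x \<^bold>= y) \<longleftrightarrow> e x = e y"
  by (simp add: sem_def feql_def env_def)

lemma sem_false [simp]: "\<not> sem E c d e \<^bold>\<bottom>"
  by (simp add: sem_def ffalse_def)

lemma sem_imp [simp]: "sem E c d e (P \<^bold>\<longrightarrow> Q) \<longleftrightarrow> (sem E c d e P \<longrightarrow> sem E c d e Q)"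
  by (simp add: sem_def fimp_def)

lemma sem_all [simp]: "sem E c d e (fall F) \<longleftrightarrow> (\<forall>a. sem E c (Suc d) (e(d := a)) (F d))"
  by (simp add: sem_def fall_def env_upd)

lemma sem_neg [simp]: "sem E c d e (\<^bold>\<not> P) \<longleftrightarrow> \<not> sem E c d e P"
  by (simp add: fneg_def)

lemma sem_conj [simp]: "sem E c d e (P \<^bold>\<and> Q) \<longleftrightarrow> sem E c d e P \<and> sem E c d e Q"
  by (simp add: fconj_def)

lemma sem_disj [simp]: "sem E c d e (P \<^bold>\<or> Q) \<longleftrightarrow> sem E c d e P \<or> sem E c d e Q"
  by (auto simp add: fdisj_def)

lemma sem_iff [simp]: "sem E c d e (P \<^bold>\<longleftrightarrow> Q) \<longleftrightarrow> (sem E c d e P \<longleftrightarrow> sem E c d e Q)"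
  by (auto simp add: fiff_def)

lemma sem_ex [simp]: "sem E c d e (fex F) \<longleftrightarrow> (\<exists>a. sem E c (Suc d) (e(d := a)) (F d))"
  by (simp add: fex_def)

lemma sat_Forall_pow:
  "sat E (env c d e) ((Forall ^^ n) p) \<longleftrightarrow> (\<forall>e'. (\<forall>x<d. e' x = e x) \<longrightarrow> sat E (env c (d + n) e') p)"
proof (induction n arbitrary: p)
  case 0
  have "env c d e' = env c d e" if "\<forall>x<d. e' x = e x" for e'
    using that by (auto simp: env_def)
  then show ?case by (metis add_0_right funpow_0)
next
  case (Suc n)
  have "(\<forall>a. sat E (env c (Suc (d + n)) (e'(d + n := a))) p) \<longleftrightarrow>
     (\<forall>e''. (\<forall>x<d + n. e'' x = e' x) \<longrightarrow> sat E (env c (Suc (d + n)) e'') p)" for e'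
  proof -
    have "env c (Suc (d + n)) e'' = env c (Suc (d + n)) (e'(d + n := e'' (d + n)))"
      if "\<forall>x<d + n. e'' x = e' x" for e''
      using that by (auto simp: env_def)
    then show ?thesis by (metis fun_upd_apply nat_less_le)
  qed
  then have "sat E (env c d e) ((Forall ^^ Suc n) p) \<longleftrightarrow>
    (\<forall>e'. (\<forall>x<d. e' x = e x) \<longrightarrow>
      (\<forall>e''. (\<forall>x<d + n. e'' x = e' x) \<longrightarrow> sat E (env c (Suc (d + n)) e'') p))"
    by (simp add: funpow_swap1 Suc.IH env_upd)
  also have "\<dots> \<longleftrightarrow> (\<forall>e'. (\<forall>x<d. e' x = e x) \<longrightarrow> sat E (env c (d + Suc n) e') p)"
    by (metis add_Suc_right trans_less_add1)
  finally show ?case .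
qed

lemma sem_param: "sem E c 0 e (param n P) \<longleftrightarrow> (\<forall>e'. sem E c n e' P)"
  using sat_Forall_pow[of E c 0 e n "P n"] by (simp add: sem_def param_def)

lemma sem_sub:
  assumes "\<And>i. i \<in> fv \<phi> \<Longrightarrow> \<sigma> i < d"
  shows "sem E c d e (sub \<phi> \<sigma>) \<longleftrightarrow> sat E (e \<circ> \<sigma>) \<phi>"
  unfolding sem_def sub_def sat_ren using assms
  by (intro sat_cong) (force simp: env_def)

text \<open>The parameters may be given by an infinite assignment \<open>v\<close>: for
  \<open>n\<close> above all free indices of \<open>\<phi>\<close>, only values below level
  \<open>n\<close> are read, and the levels from \<open>n\<close> on that are overwritten by the
  bound variables \<open>A\<close>, \<open>B\<close> and \<open>x\<close> are out of reach.\<close>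

lemma separation_sem:
  assumes ZF: "\<And>q. q \<in> ZF \<Longrightarrow> sat E c q"
  shows "\<exists>B. \<forall>x. E x B \<longleftrightarrow> E x A \<and> sat E (case_nat x v) \<phi>"
proof -
  obtain n where n: "\<forall>i \<in> fv \<phi>. i < n" using finite_fv finite_nat_set_iff_bounded by metis
  then have fv: "fv \<phi> \<subseteq> {..<n + 1}" by auto
  then have "Separation n \<phi> 0 \<in> ZF" unfolding ZF_def by blast
  then have "sat E c (Separation n \<phi> 0)" by (rule ZF)
  then have "sem E c 0 e (Separation n \<phi>)" for e by (simp add: sem_def env_def)
  then have S: "sem E c n v (\<^bold>\<forall>A. \<^bold>\<exists>B. \<^bold>\<forall>x. x \<^bold>\<in> B \<^bold>\<longleftrightarrow> x \<^bold>\<in> A \<^bold>\<and> sub \<phi> (case_nat x (\<lambda>i. i)))"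
    unfolding Separation_def sem_param by blast
  have sub: "sem E c (Suc (Suc (Suc n))) e (sub \<phi> (case_nat x (\<lambda>i. i))) \<longleftrightarrow>
      sat E (case_nat (e x) e) \<phi>" if "x < Suc (Suc (Suc n))" for e x
  proof -
    have "e \<circ> case_nat x (\<lambda>i. i) = case_nat (e x) e" by (rule ext) (simp split: nat.split)
    moreover have "case_nat x (\<lambda>i. i) i < Suc (Suc (Suc n))" if "i \<in> fv \<phi>" for i
      using \<open>x < _\<close> that n by (cases i) auto
    ultimately show ?thesis by (simp add: sem_sub)
  qed
  have v: "sat E (case_nat x (v(n := A, Suc n := B, Suc (Suc n) := x))) \<phi> \<longleftrightarrow> sat E (case_nat x v) \<phi>" for x A B
    using n by (intro sat_cong) (auto split: nat.split)
  from S show ?thesis by (simp add: sub v)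
qed

section \<open>Definability with parameters\<close>

text \<open>Even indices are the variables of a definable predicate, odd indices its parameters.\<close>

definition mix :: "(nat \<Rightarrow> 'a) \<Rightarrow> (nat \<Rightarrow> 'a) \<Rightarrow> nat \<Rightarrow> 'a" where
  "mix v c = (\<lambda>i. if even i then v (i div 2) else c (i div 2))"

lemma mix_simps [simp]: "mix v c (2 * i) = v i" "mix v c (Suc (2 * i)) = c i" "mix v c 0 = v 0"
  by (simp_all add: mix_def)

lemma even_odd_cases [case_names even odd]:
  obtains k where "(i :: nat) = 2 * k" | k where "i = Suc (2 * k)"
  by (metis evenE oddE Suc_eq_plus1)

text \<open>Definability is a semantic property of a HOL predicate on assignments, so the closure
  rules can follow the shape of the HOL term. Parameters are hidden in the existential
  \<open>c\<close>, which lets fixed elements of the model appear in the predicate.\<close>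

definition def_rel :: "('a \<Rightarrow> 'a \<Rightarrow> bool) \<Rightarrow> ((nat \<Rightarrow> 'a) \<Rightarrow> bool) \<Rightarrow> bool" where
  "def_rel E Q \<longleftrightarrow> (\<exists>\<phi> c. \<forall>v. Q v \<longleftrightarrow> sat E (mix v c) \<phi>)"

lemma def_False: "def_rel E (\<lambda>v. False)"
  unfolding def_rel_def by (intro exI[of _ Falsum]) simp

lemma def_mem_var: "def_rel E (\<lambda>v. E (v i) (v j))"
  unfolding def_rel_def by (intro exI[of _ "Mem (2 * i) (2 * j)"]) simp

lemma def_eq_var: "def_rel E (\<lambda>v. v i = v j)"
  unfolding def_rel_def by (intro exI[of _ "Eql (2 * i) (2 * j)"]) simp

lemma def_eq_const: "def_rel E (\<lambda>v. v i = a)"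
  unfolding def_rel_def by (intro exI[of _ "Eql (2 * i) (Suc 0)"] exI[of _ "\<lambda>_. a"]) (simp add: mix_def)

lemma def_imp:
  assumes "def_rel E P" "def_rel E Q"
  shows "def_rel E (\<lambda>v. P v \<longrightarrow> Q v)"
proof -
  from assms obtain \<phi> c \<psi> c' where
    P: "\<And>v. P v \<longleftrightarrow> sat E (mix v c) \<phi>" and Q: "\<And>v. Q v \<longleftrightarrow> sat E (mix v c') \<psi>"
    unfolding def_rel_def by blast
  \<comment> \<open>The two parameter sequences are interleaved into one: parameter \<open>i\<close>
    of the first formula moves to place \<open>2 * i\<close>, that of the second to place
    \<open>2 * i + 1\<close>.\<close>
  let ?f = "mix (\<lambda>i. 2 * i) (\<lambda>i. Suc (2 * (2 * i)))"
  let ?g = "mix (\<lambda>i. 2 * i) (\<lambda>i. Suc (2 * Suc (2 * i)))"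
  have "mix v (mix c c') \<circ> ?f = mix v c" "mix v (mix c c') \<circ> ?g = mix v c'" for v
  proof -
    have "(mix v (mix c c') \<circ> ?f) i = mix v c i \<and> (mix v (mix c c') \<circ> ?g) i = mix v c' i" for i
      by (cases i rule: even_odd_cases) (simp_all only: o_apply mix_simps)
    then show "mix v (mix c c') \<circ> ?f = mix v c" "mix v (mix c c') \<circ> ?g = mix v c'" by auto
  qed
  then have "(P v \<longrightarrow> Q v) \<longleftrightarrow> sat E (mix v (mix c c')) (Imp (ren ?f \<phi>) (ren ?g \<psi>))" for v
    unfolding P Q sat.simps sat_ren by simp
  then show ?thesis unfolding def_rel_def by (intro exI allI)
qed

lemma def_all:
  assumes "def_rel E (\<lambda>v. Q (v 0) (\<lambda>i. v (Suc i)))"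
  shows "def_rel E (\<lambda>v. \<forall>a. Q a v)"
proof -
  from assms obtain \<phi> c where Q: "\<And>v. Q (v 0) (\<lambda>i. v (Suc i)) \<longleftrightarrow> sat E (mix v c) \<phi>"
    unfolding def_rel_def by blast
  \<comment> \<open>Under the new quantifier, variable 0 becomes the bound index 0, while variable
    \<open>Suc i\<close> of the body is variable \<open>i\<close> outside; all outer indices,
    parameters included, are raised by one.\<close>
  let ?f = "mix (case_nat 0 (\<lambda>i. Suc (2 * i))) (\<lambda>i. Suc (Suc (2 * i)))"
  have "case_nat a (mix v c) \<circ> ?f = mix (case_nat a v) c" for a v
  proof
    fix i show "(case_nat a (mix v c) \<circ> ?f) i = mix (case_nat a v) c i"
      by (cases i rule: even_odd_cases) (auto split: nat.split)
  qed
  then have "sat E (case_nat a (mix v c)) (ren ?f \<phi>) \<longleftrightarrow> Q a v" for a v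
    using Q[of "case_nat a v"] by (simp add: sat_ren)
  then have "(\<forall>a. Q a v) \<longleftrightarrow> sat E (mix v c) (Forall (ren ?f \<phi>))" for v by simp
  then show ?thesis unfolding def_rel_def by (intro exI allI)
qed

lemma def_subst_vars:
  assumes "def_rel E Q"
  shows "def_rel E (\<lambda>v. Q (\<lambda>i. v (f i)))"
proof -
  from assms obtain \<phi> c where Q: "\<And>v. Q v \<longleftrightarrow> sat E (mix v c) \<phi>"
    unfolding def_rel_def by blast
  let ?f = "mix (\<lambda>i. 2 * f i) (\<lambda>i. Suc (2 * i))"
  have "mix v c \<circ> ?f = mix (\<lambda>i. v (f i)) c" for v
  proof
    fix i show "(mix v c \<circ> ?f) i = mix (\<lambda>i. v (f i)) c i"
      by (cases i rule: even_odd_cases) auto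
  qed
  then have "Q (\<lambda>i. v (f i)) \<longleftrightarrow> sat E (mix v c) (ren ?f \<phi>)" for v
    unfolding Q sat_ren by simp
  then show ?thesis unfolding def_rel_def by (intro exI allI)
qed

lemma def_not: "def_rel E P \<Longrightarrow> def_rel E (\<lambda>v. \<not> P v)"
  using def_imp[OF _ def_False] by simp

lemma def_const: "def_rel E (\<lambda>v. P)"
  using def_False def_not[OF def_False] by (cases P) simp_all

lemma def_disj: "def_rel E P \<Longrightarrow> def_rel E Q \<Longrightarrow> def_rel E (\<lambda>v. P v \<or> Q v)"
  using def_imp[OF def_not] by (simp add: disj_imp)

lemma def_conj: "def_rel E P \<Longrightarrow> def_rel E Q \<Longrightarrow> def_rel E (\<lambda>v. P v \<and> Q v)"
  using def_not[OF def_disj[OF def_not def_not]] by simp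

lemma def_iff: "def_rel E P \<Longrightarrow> def_rel E Q \<Longrightarrow> def_rel E (\<lambda>v. P v \<longleftrightarrow> Q v)"
  using def_conj[OF def_imp def_imp] by (simp add: iff_conv_conj_imp)

lemma def_ex:
  assumes "def_rel E (\<lambda>v. Q (v 0) (\<lambda>i. v (Suc i)))"
  shows "def_rel E (\<lambda>v. \<exists>a. Q a v)"
  using def_not[OF def_all[of E "\<lambda>a v. \<not> Q a v", OF def_not[OF assms]]] by simp

definition def_fun :: "('a \<Rightarrow> 'a \<Rightarrow> bool) \<Rightarrow> ((nat \<Rightarrow> 'a) \<Rightarrow> 'a) \<Rightarrow> bool" where
  "def_fun E t \<longleftrightarrow> def_rel E (\<lambda>v. v 0 = t (\<lambda>i. v (Suc i)))"

lemma def_fun_var: "def_fun E (\<lambda>v. v i)"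
  unfolding def_fun_def by (rule def_eq_var)

lemma def_fun_const: "def_fun E (\<lambda>v. a)"
  unfolding def_fun_def by (rule def_eq_const)

text \<open>The language has no function terms, so a definable function is eliminated by an
  existential quantifier over its value.\<close>

lemma def_subst:
  assumes "def_rel E (\<lambda>v. P (v 0) (\<lambda>i. v (Suc i)))" "def_fun E t"
  shows "def_rel E (\<lambda>v. P (t v) v)"
proof -
  have "def_rel E (\<lambda>v. \<exists>x. x = t v \<and> P x v)"
    by (intro def_ex def_conj assms(1) assms(2)[unfolded def_fun_def])
  then show ?thesis by simp
qed

lemma def_rel_app1:
  assumes "def_rel E (\<lambda>v. P (v 0))" "def_fun E s"
  shows "def_rel E (\<lambda>v. P (s v))"
  using def_subst[OF assms] .

lemma def_fun_shift: "def_fun E t \<Longrightarrow> def_fun E (\<lambda>v. t (\<lambda>i. v (f i)))"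
  unfolding def_fun_def using def_subst_vars[of E _ "case_nat 0 (\<lambda>i. Suc (f i))"] by fastforce

lemma def_rel_app2:
  assumes "def_rel E (\<lambda>v. P (v 0) (v (Suc 0)))" "def_fun E s" "def_fun E t"
  shows "def_rel E (\<lambda>v. P (s v) (t v))"
proof -
  have "def_rel E (\<lambda>v. P (v (Suc 0)) (v 0))"
    using def_subst_vars[OF assms(1), of "\<lambda>i. if i = 0 then Suc 0 else 0"] by simp
  then have "def_rel E (\<lambda>v. P (v 0) (t (\<lambda>i. v (Suc i))))"
    by (rule def_subst[where P = "\<lambda>x v. P (v 0) x", OF _ def_fun_shift[OF assms(3)]])
  then show ?thesis by (rule def_subst[OF _ assms(2)])
qed

lemma def_mem: "def_fun E s \<Longrightarrow> def_fun E t \<Longrightarrow> def_rel E (\<lambda>v. E (s v) (t v))"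
  by (rule def_rel_app2[where P = E, OF def_mem_var[of E 0 "Suc 0"]])

lemma def_eq: "def_fun E s \<Longrightarrow> def_fun E t \<Longrightarrow> def_rel E (\<lambda>v. s v = t v)"
  by (rule def_rel_app2[where P = "(=)", OF def_eq_var[of E 0 "Suc 0"]])

text \<open>In contrast to \<open>THE\<close>, the value is the same element for all \<open>P\<close> without a unique witness; this keeps
  set-theoretic terms definable.\<close>

definition the1 :: "('a \<Rightarrow> bool) \<Rightarrow> 'a" where
  "the1 P = (if \<exists>!x. P x then THE x. P x else undefined)"

lemma the1_eq: "P a \<Longrightarrow> (\<And>x. P x \<Longrightarrow> x = a) \<Longrightarrow> the1 P = a"
  unfolding the1_def by (metis the_equality)

lemma def_fun_the1:
  assumes "def_rel E (\<lambda>v. P (v 0) (\<lambda>i. v (Suc i)))"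
  shows "def_fun E (\<lambda>v. the1 (\<lambda>x. P x v))"
proof -
  \<comment> \<open>A first-order description of the graph of \<open>the1\<close>: either the unique
    witness, or the default \<open>undefined\<close>, which enters as a parameter.\<close>
  have iff: "z = the1 P' \<longleftrightarrow> (P' z \<and> (\<forall>y. P' y \<longrightarrow> y = z)) \<or>
     (\<not> (\<exists>x. P' x \<and> (\<forall>y. P' y \<longrightarrow> y = x)) \<and> z = undefined)" for z :: 'a and P'
  proof (cases "\<exists>!x. P' x")
    case True
    then obtain a where "P' a" "\<And>x. P' x \<Longrightarrow> x = a" by blast
    with the1_eq[of P' a] show ?thesis by metis
  next
    case False
    then show ?thesis unfolding the1_def by metis
  qed
  have P: "def_rel E (\<lambda>v. P (v (f 0)) (\<lambda>i. v (f (Suc i))))" for f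
    using def_subst_vars[OF assms] .
  note P1 = P[of "case_nat 0 (\<lambda>i. Suc (Suc i))", simplified]
  note P2 = P[of "case_nat 0 (\<lambda>i. Suc (Suc (Suc i)))", simplified]
  show ?thesis unfolding def_fun_def iff
    by (intro def_disj def_conj def_not def_all def_ex def_imp P1 P2 assms def_eq_var def_eq_const)
qed

lemmas def_intros = def_all def_ex def_imp def_not def_conj def_disj def_iff
  def_mem def_eq def_fun_var def_fun_the1 def_const def_fun_const

section \<open>Boolean algebras on a carrier\<close>

locale bool_alg_on =
  fixes S :: "'a set" and J M :: "'a \<Rightarrow> 'a \<Rightarrow> 'a" and C :: "'a \<Rightarrow> 'a" and e u :: 'a
  assumes J_closed: "x \<in> S \<Longrightarrow> y \<in> S \<Longrightarrow> J x y \<in> S"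
    and M_closed: "x \<in> S \<Longrightarrow> y \<in> S \<Longrightarrow> M x y \<in> S"
    and C_closed: "x \<in> S \<Longrightarrow> C x \<in> S"
    and e_closed: "e \<in> S" and u_closed: "u \<in> S"
    and laws: "\<forall>x \<in> S. \<forall>y \<in> S. \<forall>z \<in> S.
      J x y = J y x \<and> M x y = M y x \<and>
      J x (J y z) = J (J x y) z \<and> M x (M y z) = M (M x y) z \<and>
      J x (M x y) = x \<and> M x (J x y) = x \<and>
      J x (M y z) = M (J x y) (J x z) \<and> M x (J y z) = J (M x y) (M x z) \<and>
      J x (C x) = u \<and> M x (C x) = e"

definition prime_ideal ::
  "'a set \<Rightarrow> ('a \<Rightarrow> 'a \<Rightarrow> 'a) \<Rightarrow> ('a \<Rightarrow> 'a \<Rightarrow> 'a) \<Rightarrow> 'a \<Rightarrow> 'a \<Rightarrow> 'a set \<Rightarrow> bool" where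
  "prime_ideal S J M e u I \<longleftrightarrow> I \<subseteq> S \<and> e \<in> I \<and> u \<notin> I \<and>
     (\<forall>x \<in> I. \<forall>y \<in> I. J x y \<in> I) \<and> (\<forall>x \<in> I. \<forall>y \<in> S. M x y \<in> I) \<and>
     (\<forall>x \<in> S. \<forall>y \<in> S. M x y \<in> I \<longrightarrow> x \<in> I \<or> y \<in> I)"

text \<open>Bridges definable operations and the functions of the model that encode them: the two
  agree on the carrier only, where all values in the laws stay by closure.\<close>

lemma bool_alg_on_cong:
  assumes "bool_alg_on S J M C e u"
    "\<And>x y. x \<in> S \<Longrightarrow> y \<in> S \<Longrightarrow> J' x y = J x y" "\<And>x y. x \<in> S \<Longrightarrow> y \<in> S \<Longrightarrow> M' x y = M x y"
    "\<And>x. x \<in> S \<Longrightarrow> C' x = C x"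
  shows "bool_alg_on S J' M' C' e u"
proof -
  interpret bool_alg_on S J M C e u by fact
  show ?thesis
  proof
    show "\<forall>x \<in> S. \<forall>y \<in> S. \<forall>z \<in> S.
      J' x y = J' y x \<and> M' x y = M' y x \<and>
      J' x (J' y z) = J' (J' x y) z \<and> M' x (M' y z) = M' (M' x y) z \<and>
      J' x (M' x y) = x \<and> M' x (J' x y) = x \<and>
      J' x (M' y z) = M' (J' x y) (J' x z) \<and> M' x (J' y z) = J' (M' x y) (M' x z) \<and>
      J' x (C' x) = u \<and> M' x (C' x) = e"
      by (simp (no_asm) only: assms(2-4) J_closed M_closed C_closed cong: ball_cong) (rule laws)
  qed (simp_all add: assms(2-4) J_closed M_closed C_closed e_closed u_closed)
qed

context bool_alg_on
begin

lemmas closed = J_closed M_closed C_closed e_closed u_closed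

lemma M_commute: "x \<in> S \<Longrightarrow> y \<in> S \<Longrightarrow> M x y = M y x"
  using laws[rule_format, of x y x] by blast

lemma J_commute: "x \<in> S \<Longrightarrow> y \<in> S \<Longrightarrow> J x y = J y x"
  using laws[rule_format, of x y x] by blast

lemma M_assoc: "x \<in> S \<Longrightarrow> y \<in> S \<Longrightarrow> z \<in> S \<Longrightarrow> M (M x y) z = M x (M y z)"
  using laws[rule_format, of x y z] by metis

lemma M_J: "x \<in> S \<Longrightarrow> y \<in> S \<Longrightarrow> M x (J x y) = x"
  using laws[rule_format, of x y x] by blast

lemma J_M: "x \<in> S \<Longrightarrow> y \<in> S \<Longrightarrow> J x (M x y) = x"
  using laws[rule_format, of x y x] by blast

lemma M_distrib: "x \<in> S \<Longrightarrow> y \<in> S \<Longrightarrow> z \<in> S \<Longrightarrow> M x (J y z) = J (M x y) (M x z)"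
  using laws[rule_format, of x y z] by blast

lemma J_C: "x \<in> S \<Longrightarrow> J x (C x) = u"
  using laws[rule_format, of x x x] by blast

lemma M_C: "x \<in> S \<Longrightarrow> M x (C x) = e"
  using laws[rule_format, of x x x] by blast

lemma M_u: "x \<in> S \<Longrightarrow> M x u = x"
  using M_J[of x "C x"] by (simp add: J_C closed)

lemma J_e: "x \<in> S \<Longrightarrow> J x e = x"
  using J_M[of x "C x"] by (simp add: M_C closed)

lemma M_e: "x \<in> S \<Longrightarrow> M x e = e"
  using J_M[of e x] J_e[of "M e x"] J_commute[of e "M e x"] M_commute[of e x] by (simp add: closed)

lemma M_idem: "x \<in> S \<Longrightarrow> M x x = x"
  using M_J[of x e] by (simp add: J_e closed)

section \<open>Order, disjointness and three-block partitions\<close>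

definition le :: "'a \<Rightarrow> 'a \<Rightarrow> bool" where
  "le x y \<longleftrightarrow> M x y = x"

lemma le_trans: "x \<in> S \<Longrightarrow> y \<in> S \<Longrightarrow> z \<in> S \<Longrightarrow> le x y \<Longrightarrow> le y z \<Longrightarrow> le x z"
  unfolding le_def using M_assoc[of x y z] by simp

lemma le_M1: "x \<in> S \<Longrightarrow> y \<in> S \<Longrightarrow> le (M x y) x"
  unfolding le_def using M_commute[of "M x y" x] M_assoc[of x x y] by (simp add: closed M_idem)

lemma le_M2: "x \<in> S \<Longrightarrow> y \<in> S \<Longrightarrow> le (M x y) y"
  using le_M1[of y x] M_commute[of x y] by simp

lemma le_disjoint:
  assumes "x \<in> S" "y \<in> S" "le x y" "le x (C y)"
  shows "x = e"
proof -
  have "x = M (M x y) (C y)" using assms(3,4) by (simp add: le_def)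
  also have "\<dots> = M x (M y (C y))" using assms by (simp add: M_assoc closed)
  also have "\<dots> = e" using assms by (simp add: M_C M_e)
  finally show ?thesis .
qed

lemma le_J_disjoint:
  assumes "r \<in> S" "x \<in> S" "y \<in> S" "le r (J x y)" "le r (M (C x) (C y))"
  shows "r = e"
proof -
  have C: "C x \<in> S" "C y \<in> S" "M (C x) (C y) \<in> S" using assms(2,3) by (simp_all add: closed)
  have "le r (C x)" by (rule le_trans[OF assms(1) C(3,1) assms(5) le_M1[OF C(1,2)]])
  have "le r (C y)" by (rule le_trans[OF assms(1) C(3,2) assms(5) le_M2[OF C(1,2)]])
  have "M r z = e" if "z \<in> S" "le r (C z)" for z
  proof (rule le_disjoint[of _ z])
    show "le (M r z) z" using assms that by (simp add: le_M2)
    show "le (M r z) (C z)"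
      by (rule le_trans[OF M_closed[OF assms(1) that(1)] assms(1) C_closed[OF that(1)]
        le_M1[OF assms(1) that(1)] that(2)])
  qed (simp_all add: assms(1) that(1) closed)
  then have "M r x = e" "M r y = e" using \<open>le r (C x)\<close> \<open>le r (C y)\<close> assms by auto
  then have "M r (J x y) = e" using assms by (simp add: M_distrib J_e closed)
  with assms(4) show ?thesis by (simp add: le_def)
qed

lemma M_cover:
  assumes "p \<in> S" "a \<in> S" "M p a = e" "M p (C a) = e"
  shows "p = e"
proof -
  have "p = M p (J a (C a))" using assms by (simp add: J_C M_u)
  also have "\<dots> = e" using assms by (simp add: M_distrib J_e closed)
  finally show ?thesis .
qed

text \<open>Split \<open>p\<close> by \<open>a\<close>, then the part below \<open>a\<close> by
  \<open>b\<close>. This allows a nonzero lower bound to be refined one antichain at a time.\<close>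

lemma partition_meets:
  assumes "p \<in> S" "p \<noteq> e" "a \<in> S" "b \<in> S"
  shows "M p (M a b) \<noteq> e \<or> M p (M a (C b)) \<noteq> e \<or> M p (C a) \<noteq> e"
proof (rule ccontr)
  assume "\<not> ?thesis"
  then have *: "M (M p a) b = e" "M (M p a) (C b) = e" "M p (C a) = e"
    using assms by (auto simp: M_assoc closed)
  have "M p a = e" using M_cover[OF _ assms(4) *(1,2)] assms by (simp add: closed)
  then have "p = e" using M_cover[OF assms(1,3) _ *(3)] by simp
  with assms(2) show False by simp
qed

text \<open>Three-block partitions suffice to make a linked family of nonzero elements closed under meets:
  two of \<open>a\<close>, \<open>b\<close> and one block of \<open>{a \<and> b, a \<and> \<not> b, \<not> a}\<close> can only be
  pairwise compatible if the block is \<open>a \<and> b\<close>.\<close>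

lemma prime_ideal_of_linked:
  assumes G: "G \<subseteq> S"
    and linked: "\<And>p q. p \<in> G \<Longrightarrow> q \<in> G \<Longrightarrow> \<exists>r \<in> S. r \<noteq> e \<and> le r p \<and> le r q"
    and generic: "\<And>a b. a \<in> S \<Longrightarrow> b \<in> S \<Longrightarrow> M a b \<in> G \<or> M a (C b) \<in> G \<or> C a \<in> G"
  shows "prime_ideal S J M e u (S - G)"
proof -
  have sub: "x \<in> S" if "x \<in> G" for x using G that by blast
  have disj: False if "p \<in> G" "q \<in> G" "a \<in> S" "le p a" "le q (C a)" for p q a
  proof -
    obtain r where r: "r \<in> S" "r \<noteq> e" "le r p" "le r q" using linked \<open>p \<in> G\<close> \<open>q \<in> G\<close> by blast
    have "le r a" using le_trans[OF r(1) sub[OF that(1)] that(3) r(3) that(4)] .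
    moreover have "le r (C a)" using le_trans[OF r(1) sub[OF that(2)] C_closed[OF that(3)] r(4) that(5)] .
    ultimately show False using le_disjoint r(1,2) that(3) by blast
  qed
  have refl: "le x x" if "x \<in> S" for x using that by (simp add: le_def M_idem)
  have e: "e \<notin> G"
  proof
    assume "e \<in> G"
    then obtain r where r: "r \<in> S" "r \<noteq> e" "le r e" using linked by blast
    then show False by (simp add: le_def M_e)
  qed
  \<comment> \<open>For \<open>b = a\<close> the three blocks degenerate to \<open>a\<close>,
    \<open>e\<close> and \<open>C a\<close>, and \<open>e\<close> is not in
    \<open>G\<close>.\<close>
  have compl: "a \<in> G \<or> C a \<in> G" if "a \<in> S" for a
    using generic[OF that that] that e by (simp add: M_C M_idem)
  have M: "M a b \<in> G" if "a \<in> G" "b \<in> G" for a b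
  proof -
    have a: "a \<in> S" and b: "b \<in> S" using sub that by auto
    have "M a (C b) \<notin> G"
    proof
      assume "M a (C b) \<in> G"
      from disj[OF that(2) this b refl[OF b] le_M2[OF a C_closed[OF b]]] show False .
    qed
    moreover have "C a \<notin> G"
    proof
      assume "C a \<in> G"
      from disj[OF that(1) this a refl[OF a] refl[OF C_closed[OF a]]] show False .
    qed
    ultimately show ?thesis using generic[OF a b] by blast
  qed
  have up: "b \<in> G" if "a \<in> G" "b \<in> S" "le a b" for a b
  proof (rule ccontr)
    assume "b \<notin> G"
    then have "C b \<in> G" using compl[OF that(2)] by blast
    from disj[OF that(1) this that(2,3) refl[OF C_closed[OF that(2)]]] show False .
  qed
  show ?thesis unfolding prime_ideal_def
  proof (intro conjI ballI impI)
    show "S - G \<subseteq> S" "e \<in> S - G" using e e_closed by auto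
    obtain g where "g \<in> G" using compl[OF e_closed] by blast
    have "le g u" using M_u[OF sub[OF \<open>g \<in> G\<close>]] by (simp add: le_def)
    from up[OF \<open>g \<in> G\<close> u_closed this] show "u \<notin> S - G" by blast
  next
    fix x y assume x: "x \<in> S - G" and y: "y \<in> S - G"
    then have "M (C x) (C y) \<in> G" using compl M by blast
    have "J x y \<notin> G"
    proof
      assume "J x y \<in> G"
      then obtain r where r: "r \<in> S" "r \<noteq> e" "le r (J x y)" "le r (M (C x) (C y))"
        using linked[OF _ \<open>M (C x) (C y) \<in> G\<close>] by blast
      then show False using le_J_disjoint[OF r(1) _ _ r(3,4)] x y by blast
    qed
    then show "J x y \<in> S - G" using x y J_closed by blast
  next
    fix x y assume x: "x \<in> S - G" and y: "y \<in> S"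
    have "M x y \<notin> G" using up[of "M x y" x] le_M1[of x y] x y by blast
    then show "M x y \<in> S - G" using x y M_closed by blast
  next
    fix x y assume "x \<in> S" "y \<in> S" "M x y \<in> S - G"
    then show "x \<in> S - G \<or> y \<in> S - G" using M by blast
  qed
qed

end

section \<open>Set theory in a model\<close>

text \<open>A new variable is stored at the current depth and older variables lie below it, so this
  reads older values through the update.\<close>

lemma upd_less [simp]: "x < y \<Longrightarrow> (e(y := a)) x = e (x :: nat)"
  by simp

locale zf_model =
  fixes E :: "'a \<Rightarrow> 'a \<Rightarrow> bool" (infix "\<epsilon>" 50) and c :: "nat \<Rightarrow> 'a"
  assumes ZF: "q \<in> ZF \<Longrightarrow> sat E c q"
begin

abbreviation "sm \<equiv> sem E c"

abbreviation D :: "((nat \<Rightarrow> 'a) \<Rightarrow> bool) \<Rightarrow> bool" where "D \<equiv> def_rel E"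
abbreviation DF :: "((nat \<Rightarrow> 'a) \<Rightarrow> 'a) \<Rightarrow> bool" where "DF \<equiv> def_fun E"

section \<open>Axioms and set operations inside the model\<close>

lemma axiom_sem: "P 0 \<in> ZF \<Longrightarrow> sm 0 e P"
  using ZF[of "P 0"] by (simp add: sem_def env_def)

lemma extensionality: "(\<And>z. z \<epsilon> x \<longleftrightarrow> z \<epsilon> y) \<Longrightarrow> x = y"
  using axiom_sem[of Extensionality undefined] by (simp add: Extensionality_def ZF_def)

lemma eq_iff_mem: "x = y \<longleftrightarrow> (\<forall>z. z \<epsilon> x \<longleftrightarrow> z \<epsilon> y)"
  using extensionality by blast

lemma foundation: "y \<epsilon> x \<Longrightarrow> \<exists>y. y \<epsilon> x \<and> (\<forall>z. z \<epsilon> x \<longrightarrow> \<not> z \<epsilon> y)"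
proof -
  have "\<forall>x. (\<exists>y. y \<epsilon> x) \<longrightarrow> (\<exists>y. y \<epsilon> x \<and> (\<forall>z. z \<epsilon> x \<longrightarrow> \<not> z \<epsilon> y))"
    using axiom_sem[of Foundation undefined] by (simp add: Foundation_def ZF_def)
  then show "y \<epsilon> x \<Longrightarrow> \<exists>y. y \<epsilon> x \<and> (\<forall>z. z \<epsilon> x \<longrightarrow> \<not> z \<epsilon> y)" by blast
qed

lemma ex_upair: "\<exists>p. \<forall>z. z \<epsilon> p \<longleftrightarrow> z = a \<or> z = b"
  using axiom_sem[of Pairing undefined] by (simp add: Pairing_def is_upair_def ZF_def)

lemma ex_Union: "\<exists>U. \<forall>x. x \<epsilon> U \<longleftrightarrow> (\<exists>y. y \<epsilon> A \<and> x \<epsilon> y)"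
  using axiom_sem[of Union undefined] by (simp add: Union_def ZF_def)

lemma ex_Pow: "\<exists>U. \<forall>x. x \<epsilon> U \<longleftrightarrow> (\<forall>z. z \<epsilon> x \<longrightarrow> z \<epsilon> A)"
  using axiom_sem[of Powerset undefined] by (simp add: Powerset_def fsubset_def ZF_def)

lemma separation:
  assumes "D (\<lambda>v. R (v 0))"
  shows "\<exists>B. \<forall>x. x \<epsilon> B \<longleftrightarrow> x \<epsilon> A \<and> R x"
proof -
  from assms obtain \<phi> c' where R: "\<And>v. R (v 0) \<longleftrightarrow> sat E (mix v c') \<phi>"
    unfolding def_rel_def by blast
  \<comment> \<open>In \<open>separation_sem\<close> index 0 is \<open>x\<close> and the later
    indices are parameters: all variables of the definable predicate collapse to 0, and parameter
    \<open>i\<close> goes to \<open>Suc i\<close>.\<close>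
  have "case_nat x c' \<circ> mix (\<lambda>i. 0) Suc = mix (\<lambda>i. x) c'" for x
    by (rule ext) (simp add: mix_def)
  then have "R x \<longleftrightarrow> sat E (case_nat x c') (ren (mix (\<lambda>i. 0) Suc) \<phi>)" for x
    using R[of "\<lambda>i. x"] by (simp add: sat_ren)
  with separation_sem[OF ZF, of A c' "ren (mix (\<lambda>i. 0) Suc) \<phi>"] show ?thesis by simp
qed

definition collect :: "'a \<Rightarrow> ('a \<Rightarrow> bool) \<Rightarrow> 'a" where
  "collect A R = the1 (\<lambda>B. \<forall>x. x \<epsilon> B \<longleftrightarrow> x \<epsilon> A \<and> R x)"

lemma the1_set: "\<exists>B. \<forall>x. x \<epsilon> B \<longleftrightarrow> Q x \<Longrightarrow> x \<epsilon> the1 (\<lambda>B. \<forall>x. x \<epsilon> B \<longleftrightarrow> Q x) \<longleftrightarrow> Q x"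
proof -
  assume "\<exists>B. \<forall>x. x \<epsilon> B \<longleftrightarrow> Q x"
  then obtain B where B: "\<And>x. x \<epsilon> B \<longleftrightarrow> Q x" by blast
  have "the1 (\<lambda>B. \<forall>x. x \<epsilon> B \<longleftrightarrow> Q x) = B"
    by (rule the1_eq) (simp_all add: B extensionality)
  then show ?thesis by (simp add: B)
qed

lemma mem_collect: "D (\<lambda>v. R (v 0)) \<Longrightarrow> x \<epsilon> collect A R \<longleftrightarrow> x \<epsilon> A \<and> R x"
  unfolding collect_def by (rule the1_set[OF separation])

lemma def_collect:
  assumes "DF A" "D (\<lambda>v. R (v 0) (\<lambda>i. v (Suc i)))"
  shows "DF (\<lambda>v. collect (A v) (\<lambda>x. R x v))"
proof -
  have "D (\<lambda>v. R (v 0) (\<lambda>i. v (Suc (Suc i))))"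
    using def_subst_vars[OF assms(2), of "case_nat 0 (\<lambda>i. Suc (Suc i))"] by simp
  then show ?thesis unfolding collect_def
    by (intro def_intros def_fun_shift[OF assms(1)])
qed

definition upair :: "'a \<Rightarrow> 'a \<Rightarrow> 'a" where
  "upair a b = the1 (\<lambda>p. \<forall>z. z \<epsilon> p \<longleftrightarrow> z = a \<or> z = b)"

definition opair :: "'a \<Rightarrow> 'a \<Rightarrow> 'a" where
  "opair a b = upair (upair a a) (upair a b)"

definition bigunion :: "'a \<Rightarrow> 'a" where
  "bigunion A = the1 (\<lambda>U. \<forall>x. x \<epsilon> U \<longleftrightarrow> (\<exists>y. y \<epsilon> A \<and> x \<epsilon> y))"

definition union :: "'a \<Rightarrow> 'a \<Rightarrow> 'a" where
  "union a b = bigunion (upair a b)"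

definition pow :: "'a \<Rightarrow> 'a" where
  "pow A = the1 (\<lambda>U. \<forall>x. x \<epsilon> U \<longleftrightarrow> (\<forall>z. z \<epsilon> x \<longrightarrow> z \<epsilon> A))"

definition empty :: 'a where
  "empty = collect undefined (\<lambda>x. False)"

definition succ :: "'a \<Rightarrow> 'a" where
  "succ x = union x (upair x x)"

definition prod :: "'a \<Rightarrow> 'a \<Rightarrow> 'a" where
  "prod A B = collect (pow (pow (union A B))) (\<lambda>p. \<exists>a b. a \<epsilon> A \<and> b \<epsilon> B \<and> p = opair a b)"

lemma mem_upair [simp]: "z \<epsilon> upair a b \<longleftrightarrow> z = a \<or> z = b"
  unfolding upair_def by (rule the1_set[OF ex_upair])

lemma mem_bigunion [simp]: "x \<epsilon> bigunion A \<longleftrightarrow> (\<exists>y. y \<epsilon> A \<and> x \<epsilon> y)"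
  unfolding bigunion_def by (rule the1_set[OF ex_Union])

lemma mem_union [simp]: "x \<epsilon> union a b \<longleftrightarrow> x \<epsilon> a \<or> x \<epsilon> b"
  unfolding union_def by auto

lemma mem_pow [simp]: "x \<epsilon> pow A \<longleftrightarrow> (\<forall>z. z \<epsilon> x \<longrightarrow> z \<epsilon> A)"
  unfolding pow_def by (rule the1_set[OF ex_Pow])

lemma mem_empty [simp]: "\<not> x \<epsilon> empty"
  unfolding empty_def by (simp add: mem_collect def_const)

lemma mem_succ [simp]: "z \<epsilon> succ x \<longleftrightarrow> z \<epsilon> x \<or> z = x"
  unfolding succ_def by simp

lemma def_upair: "DF s \<Longrightarrow> DF t \<Longrightarrow> DF (\<lambda>v. upair (s v) (t v))"
  unfolding upair_def by (intro def_intros; erule def_fun_shift)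

lemma def_opair: "DF s \<Longrightarrow> DF t \<Longrightarrow> DF (\<lambda>v. opair (s v) (t v))"
  unfolding opair_def by (intro def_upair)

lemma def_bigunion: "DF s \<Longrightarrow> DF (\<lambda>v. bigunion (s v))"
  unfolding bigunion_def by (intro def_intros; erule def_fun_shift)

lemma def_union: "DF s \<Longrightarrow> DF t \<Longrightarrow> DF (\<lambda>v. union (s v) (t v))"
  unfolding union_def by (intro def_bigunion def_upair)

lemma def_pow: "DF s \<Longrightarrow> DF (\<lambda>v. pow (s v))"
  unfolding pow_def by (intro def_intros; erule def_fun_shift)

lemma def_succ: "DF s \<Longrightarrow> DF (\<lambda>v. succ (s v))"
  unfolding succ_def by (intro def_union def_upair)

lemma upair_eq: "upair a b = upair a' b' \<longleftrightarrow> a = a' \<and> b = b' \<or> a = b' \<and> b = a'"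
proof
  assume "upair a b = upair a' b'"
  then have "z = a \<or> z = b \<longleftrightarrow> z = a' \<or> z = b'" for z
    using mem_upair[of z a b] mem_upair[of z a' b'] by simp
  then show "a = a' \<and> b = b' \<or> a = b' \<and> b = a'" by metis
qed (auto intro: extensionality)

lemma opair_eq [simp]: "opair a b = opair a' b' \<longleftrightarrow> a = a' \<and> b = b'"
  unfolding opair_def upair_eq by auto

lemma mem_prod [simp]: "p \<epsilon> prod A B \<longleftrightarrow> (\<exists>a b. a \<epsilon> A \<and> b \<epsilon> B \<and> p = opair a b)"
proof -
  have "D (\<lambda>v. \<exists>a b. a \<epsilon> A \<and> b \<epsilon> B \<and> v 0 = opair a b)" by (intro def_intros def_opair)
  then show ?thesis unfolding prod_def by (auto simp: mem_collect) (auto simp: opair_def)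
qed

section \<open>Internal natural numbers, functions, and the meaning of the basic formulas\<close>

definition inductively_closed :: "'a \<Rightarrow> bool" where
  "inductively_closed w \<longleftrightarrow> empty \<epsilon> w \<and> (\<forall>x. x \<epsilon> w \<longrightarrow> succ x \<epsilon> w)"

definition natural :: "'a \<Rightarrow> bool" where
  "natural n \<longleftrightarrow> (\<forall>w. inductively_closed w \<longrightarrow> n \<epsilon> w)"

lemma def_natural: "D (\<lambda>v. natural (v i))"
  unfolding natural_def inductively_closed_def by (intro def_intros def_succ)

lemma sem_subset [simp]: "x < d \<Longrightarrow> y < d \<Longrightarrow> sm d e (x \<^bold>\<subseteq> y) \<longleftrightarrow> (\<forall>z. z \<epsilon> e x \<longrightarrow> z \<epsilon> e y)"
  by (simp add: fsubset_def)

lemma sem_empty [simp]: "x < d \<Longrightarrow> sm d e (is_empty x) \<longleftrightarrow> e x = empty"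
  by (simp add: is_empty_def eq_iff_mem)

lemma sem_succ [simp]: "x < d \<Longrightarrow> y < d \<Longrightarrow> sm d e (is_succ x y) \<longleftrightarrow> e y = succ (e x)"
  by (simp add: is_succ_def eq_iff_mem)

lemma sem_inductive [simp]: "w < d \<Longrightarrow> sm d e (is_inductive w) \<longleftrightarrow> inductively_closed (e w)"
  by (simp add: is_inductive_def inductively_closed_def)

lemma sem_nat [simp]: "n < d \<Longrightarrow> sm d e (is_nat n) \<longleftrightarrow> natural (e n)"
  by (simp add: is_nat_def natural_def)

lemma sem_upair [simp]: "a < d \<Longrightarrow> b < d \<Longrightarrow> p < d \<Longrightarrow> sm d e (is_upair a b p) \<longleftrightarrow> e p = upair (e a) (e b)"
  by (simp add: is_upair_def eq_iff_mem)

lemma sem_pair [simp]: "a < d \<Longrightarrow> b < d \<Longrightarrow> p < d \<Longrightarrow> sm d e (is_pair a b p) \<longleftrightarrow> e p = opair (e a) (e b)"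
  by (simp add: is_pair_def opair_def)

lemma sem_rel [simp]: "a < d \<Longrightarrow> b < d \<Longrightarrow> R < d \<Longrightarrow> sm d e (rel R a b) \<longleftrightarrow> opair (e a) (e b) \<epsilon> e R"
  by (simp add: rel_def)

lemma sem_prod [simp]: "A < d \<Longrightarrow> B < d \<Longrightarrow> X < d \<Longrightarrow> sm d e (is_prod A B X) \<longleftrightarrow> e X = prod (e A) (e B)"
  by (simp add: is_prod_def eq_iff_mem)

lemma sem_is_rel [simp]: "A < d \<Longrightarrow> B < d \<Longrightarrow> R < d \<Longrightarrow>
  sm d e (is_rel R A B) \<longleftrightarrow> (\<forall>p. p \<epsilon> e R \<longrightarrow> p \<epsilon> prod (e A) (e B))"
  by (simp add: is_rel_def)

definition funct :: "'a \<Rightarrow> 'a \<Rightarrow> 'a \<Rightarrow> bool" where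
  "funct f A B \<longleftrightarrow> (\<forall>p. p \<epsilon> f \<longrightarrow> p \<epsilon> prod A B) \<and>
     (\<forall>a. a \<epsilon> A \<longrightarrow> (\<exists>b. opair a b \<epsilon> f \<and> (\<forall>c. opair a c \<epsilon> f \<longrightarrow> c = b)))"

lemma sem_fun [simp]: "A < d \<Longrightarrow> B < d \<Longrightarrow> f < d \<Longrightarrow> sm d e (is_fun f A B) \<longleftrightarrow> funct (e f) (e A) (e B)"
  by (simp add: is_fun_def funct_def)

definition app :: "'a \<Rightarrow> 'a \<Rightarrow> 'a" where
  "app f a = the1 (\<lambda>b. opair a b \<epsilon> f)"

lemma def_app: "DF s \<Longrightarrow> DF t \<Longrightarrow> DF (\<lambda>v. app (s v) (t v))"
  unfolding app_def by (intro def_intros def_opair; erule def_fun_shift)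

lemma funct_sub: "funct f A B \<Longrightarrow> opair a b \<epsilon> f \<Longrightarrow> a \<epsilon> A \<and> b \<epsilon> B"
proof -
  assume "funct f A B" "opair a b \<epsilon> f"
  then have "opair a b \<epsilon> prod A B" by (simp only: funct_def)
  then show ?thesis by auto
qed

lemma funct_ex: "funct f A B \<Longrightarrow> a \<epsilon> A \<Longrightarrow> \<exists>b. opair a b \<epsilon> f \<and> (\<forall>c. opair a c \<epsilon> f \<longrightarrow> c = b)"
  by (simp only: funct_def)

lemma funct_app:
  assumes "funct f A B" "a \<epsilon> A"
  shows "app f a \<epsilon> B" "opair a b \<epsilon> f \<longleftrightarrow> b = app f a"
proof -
  from funct_ex[OF assms] obtain b' where b': "opair a b' \<epsilon> f" "\<And>c. opair a c \<epsilon> f \<Longrightarrow> c = b'"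
    by metis
  have app: "app f a = b'" unfolding app_def by (rule the1_eq) (fact b')+
  show "app f a \<epsilon> B" using funct_sub[OF assms(1) b'(1)] app by simp
  show "opair a b \<epsilon> f \<longleftrightarrow> b = app f a" unfolding app using b' by metis
qed

lemmas def_terms = def_intros def_upair def_opair def_bigunion def_union def_pow def_succ def_app

text \<open>The bound \<open>B\<close> on the values is what lets Separation inside
  \<open>prod A B\<close> produce the graph.\<close>

lemma ex_function:
  assumes "DF (\<lambda>v. g (v 0))" "\<And>a. a \<epsilon> A \<Longrightarrow> g a \<epsilon> B"
  shows "\<exists>f. funct f A B \<and> (\<forall>a. a \<epsilon> A \<longrightarrow> app f a = g a)"
proof -
  have g: "DF (\<lambda>v. g (v i))" for i using def_fun_shift[OF assms(1), of "\<lambda>_. i"] .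
  have "D (\<lambda>v. \<exists>a. v 0 = opair a (g a))" by (intro def_terms g)
  then have "\<exists>f. \<forall>p. p \<epsilon> f \<longleftrightarrow> p \<epsilon> prod A B \<and> (\<exists>a. p = opair a (g a))" by (rule separation)
  then obtain f where f: "\<And>p. p \<epsilon> f \<longleftrightarrow> p \<epsilon> prod A B \<and> (\<exists>a. p = opair a (g a))" by blast
  have F: "funct f A B" unfolding funct_def using assms(2) by (simp add: f)
  moreover have "app f a = g a" if "a \<epsilon> A" for a
  proof -
    have "opair a (g a) \<epsilon> f" using that assms(2) by (simp add: f)
    with funct_app(2)[OF F that] show ?thesis by simp
  qed
  ultimately show ?thesis by blast
qed

lemma ex_function2:
  assumes "DF (\<lambda>v. g (v 0) (v (Suc 0)))" "\<And>a b. a \<epsilon> A \<Longrightarrow> b \<epsilon> A' \<Longrightarrow> g a b \<epsilon> B"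
  shows "\<exists>f. funct f (prod A A') B \<and> (\<forall>a b. a \<epsilon> A \<longrightarrow> b \<epsilon> A' \<longrightarrow> app f (opair a b) = g a b)"
proof -
  have g: "DF (\<lambda>v. g (v i) (v j))" for i j
    using def_fun_shift[OF assms(1), of "\<lambda>k. if k = 0 then i else j"] by simp
  have "D (\<lambda>v. \<exists>a b. v 0 = opair (opair a b) (g a b))" by (intro def_terms g)
  then have "\<exists>f. \<forall>p. p \<epsilon> f \<longleftrightarrow> p \<epsilon> prod (prod A A') B \<and> (\<exists>a b. p = opair (opair a b) (g a b))"
    by (rule separation)
  then obtain f where
    f: "\<And>p. p \<epsilon> f \<longleftrightarrow> p \<epsilon> prod (prod A A') B \<and> (\<exists>a b. p = opair (opair a b) (g a b))" by blast
  have F: "funct f (prod A A') B" unfolding funct_def using assms(2) by (auto simp add: f)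
  moreover have "app f (opair a b) = g a b" if "a \<epsilon> A" "b \<epsilon> A'" for a b
  proof -
    have "opair (opair a b) (g a b) \<epsilon> f" using that assms(2) by (simp add: f)
    moreover have "opair a b \<epsilon> prod A A'" using that by simp
    ultimately show ?thesis using funct_app(2)[OF F] by metis
  qed
  ultimately show ?thesis by blast
qed

lemma natural_empty: "natural empty"
  unfolding natural_def inductively_closed_def by blast

lemma natural_succ: "natural n \<Longrightarrow> natural (succ n)"
  unfolding natural_def inductively_closed_def by blast

text \<open>The definable predicate cuts a subset out of an inductive set; this subset is again
  inductive, so it contains every internal natural number.\<close>

lemma natural_induct [consumes 2, case_names empty succ]:
  assumes "natural n" "D (\<lambda>v. R (v 0))" "R empty" "\<And>n. natural n \<Longrightarrow> R n \<Longrightarrow> R (succ n)"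
  shows "R n"
proof -
  obtain w where w: "inductively_closed w"
    using axiom_sem[of Infinity undefined] by (auto simp: Infinity_def ZF_def)
  \<comment> \<open>Including \<open>natural\<close> in the separated predicate lets the successor
    step assume that its argument is an internal natural number.\<close>
  have "D (\<lambda>v. natural (v 0) \<and> R (v 0))" by (intro def_conj def_natural assms)
  from separation[OF this] obtain w' where w': "x \<epsilon> w' \<longleftrightarrow> x \<epsilon> w \<and> natural x \<and> R x" for x by blast
  have "inductively_closed w'"
    using w assms(3,4) natural_empty natural_succ unfolding inductively_closed_def w' by blast
  then have "n \<epsilon> w'" using assms(1) unfolding natural_def by blast
  then show ?thesis by (simp add: w')
qed

lemma not_mem_self: "\<not> x \<epsilon> x"
  using foundation[of x "upair x x"] by auto

lemma funct_empty: "funct empty empty B"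
  by (simp add: funct_def)

lemma succ_nonempty: "succ n \<noteq> empty"
  by (metis mem_empty mem_succ)

text \<open>Appends the value \<open>x\<close> at position \<open>n\<close>; Foundation gives that
  \<open>n\<close> is not a member of \<open>n\<close>, so the position is free. The codomain may
  grow, which serves enumerations of growing sets as well as sequences in a fixed family.\<close>

lemma funct_extend:
  assumes "funct f n A" "\<And>y. y \<epsilon> A \<Longrightarrow> y \<epsilon> B" "x \<epsilon> B"
  shows "\<exists>g. funct g (succ n) B \<and> (\<forall>k y. opair k y \<epsilon> g \<longleftrightarrow> opair k y \<epsilon> f \<or> k = n \<and> y = x)"
proof -
  define g where "g = union f (upair (opair n x) (opair n x))"
  have g: "opair k y \<epsilon> g \<longleftrightarrow> opair k y \<epsilon> f \<or> k = n \<and> y = x" for k y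
    by (simp add: g_def)
  have n: "\<not> opair n y \<epsilon> f" for y
    using funct_sub[OF assms(1), of n y] not_mem_self[of n] by blast
  have "funct g (succ n) B" unfolding funct_def
  proof (intro conjI allI impI)
    fix p assume "p \<epsilon> g"
    then have "p \<epsilon> f \<or> p = opair n x" by (simp add: g_def)
    then show "p \<epsilon> prod (succ n) B"
    proof
      assume "p \<epsilon> f"
      then have "p \<epsilon> prod n A" using assms(1) by (simp only: funct_def)
      then obtain a b where "a \<epsilon> n" "b \<epsilon> A" "p = opair a b" unfolding mem_prod by blast
      then show ?thesis using assms(2) by simp
    next
      assume "p = opair n x"
      then show ?thesis using assms(3) by simp
    qed
  next
    fix k assume "k \<epsilon> succ n"
    then have "k \<epsilon> n \<or> k = n" by simp
    then show "\<exists>b. opair k b \<epsilon> g \<and> (\<forall>c. opair k c \<epsilon> g \<longrightarrow> c = b)"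
    proof
      assume k: "k \<epsilon> n"
      then have "k \<noteq> n" using not_mem_self by blast
      with funct_ex[OF assms(1) k] show ?thesis unfolding g by simp
    next
      assume "k = n"
      with n show ?thesis unfolding g by simp
    qed
  qed
  with g show ?thesis by blast
qed

section \<open>Finite sets\<close>

definition fin :: "'a \<Rightarrow> bool" where
  "fin A \<longleftrightarrow> (\<exists>n f. natural n \<and> funct f n A \<and>
     (\<forall>k k' a. opair k a \<epsilon> f \<and> opair k' a \<epsilon> f \<longrightarrow> k = k') \<and> (\<forall>a. a \<epsilon> A \<longrightarrow> (\<exists>k. opair k a \<epsilon> f)))"

lemma fin_empty: "fin empty"
  unfolding fin_def using natural_empty funct_empty by (intro exI[of _ empty]) simp

lemma fin_insert:
  assumes "fin A" "\<And>z. z \<epsilon> A' \<Longrightarrow> z \<epsilon> A \<or> z = x" "\<And>z. z \<epsilon> A \<Longrightarrow> z \<epsilon> A'"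
  shows "fin A'"
proof (cases "x \<epsilon> A' \<and> \<not> x \<epsilon> A")
  case False
  have "A' = A"
  proof (rule extensionality)
    show "z \<epsilon> A' \<longleftrightarrow> z \<epsilon> A" for z using assms(2,3)[of z] False by blast
  qed
  with assms(1) show ?thesis by simp
next
  case True
  from assms(1) obtain n f where f: "natural n" "funct f n A"
    "\<And>k k' a. opair k a \<epsilon> f \<Longrightarrow> opair k' a \<epsilon> f \<Longrightarrow> k = k'" "\<And>a. a \<epsilon> A \<Longrightarrow> \<exists>k. opair k a \<epsilon> f"
    unfolding fin_def by blast
  from funct_extend[OF f(2) assms(3) conjunct1[OF True]] obtain g where
    g: "funct g (succ n) A'" "\<And>k y. opair k y \<epsilon> g \<longleftrightarrow> opair k y \<epsilon> f \<or> k = n \<and> y = x" by blast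
  have x: "\<not> opair k x \<epsilon> f" for k using funct_sub[OF f(2)] True by blast
  have "k = k'" if "opair k a \<epsilon> g" "opair k' a \<epsilon> g" for k k' a
    using that x f(3) unfolding g(2) by blast
  moreover have "\<exists>k. opair k a \<epsilon> g" if "a \<epsilon> A'" for a
    using assms(2)[OF that] f(4) unfolding g(2) by blast
  ultimately show ?thesis
    unfolding fin_def using natural_succ[OF f(1)] g(1) by blast
qed

text \<open>Only an upper bound on the members is assumed, because blocks of a partition may
  coincide or be dropped as zero.\<close>

lemma fin_three:
  assumes "\<And>z. z \<epsilon> X \<Longrightarrow> z = x \<or> z = y \<or> z = w"
  shows "fin X"
proof -
  have "D (\<lambda>v. v 0 = x)" by (intro def_terms)
  then have 1: "z \<epsilon> collect X (\<lambda>z. z = x) \<longleftrightarrow> z \<epsilon> X \<and> z = x" for z by (rule mem_collect)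
  have "D (\<lambda>v. v 0 = x \<or> v 0 = y)" by (intro def_terms)
  then have 2: "z \<epsilon> collect X (\<lambda>z. z = x \<or> z = y) \<longleftrightarrow> z \<epsilon> X \<and> (z = x \<or> z = y)" for z
    by (rule mem_collect)
  have "fin (collect X (\<lambda>z. z = x))" by (rule fin_insert[OF fin_empty, of _ x]) (auto simp: 1)
  then have "fin (collect X (\<lambda>z. z = x \<or> z = y))" by (rule fin_insert[of _ _ y]) (auto simp: 1 2)
  then show ?thesis by (rule fin_insert[of _ _ w]) (use assms in \<open>auto simp: 2\<close>)
qed

lemma sem_finite [simp]: "A < d \<Longrightarrow> sm d e (is_finite A) \<longleftrightarrow> fin (e A)"
  by (simp add: is_finite_def is_bij_def fin_def)

section \<open>The two statements evaluated in the model\<close>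

definition porder :: "'a \<Rightarrow> 'a \<Rightarrow> bool" where
  "porder P L \<longleftrightarrow> (\<forall>x. x \<epsilon> L \<longrightarrow> x \<epsilon> prod P P) \<and> (\<forall>p. p \<epsilon> P \<longrightarrow> opair p p \<epsilon> L) \<and>
     (\<forall>p q. opair p q \<epsilon> L \<and> opair q p \<epsilon> L \<longrightarrow> p = q) \<and>
     (\<forall>p q r. opair p q \<epsilon> L \<and> opair q r \<epsilon> L \<longrightarrow> opair p r \<epsilon> L)"

lemma sem_porder [simp]: "P < d \<Longrightarrow> L < d \<Longrightarrow> sm d e (is_partial_order P L) \<longleftrightarrow> porder (e P) (e L)"
  by (simp add: is_partial_order_def porder_def)

definition compat :: "'a \<Rightarrow> 'a \<Rightarrow> 'a \<Rightarrow> 'a \<Rightarrow> bool" where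
  "compat P L p q \<longleftrightarrow> (\<exists>r. r \<epsilon> P \<and> opair r p \<epsilon> L \<and> opair r q \<epsilon> L)"

lemma sem_compat [simp]: "P < d \<Longrightarrow> L < d \<Longrightarrow> p < d \<Longrightarrow> q < d \<Longrightarrow>
   sm d e (compatible P L p q) \<longleftrightarrow> compat (e P) (e L) (e p) (e q)"
  by (simp add: compatible_def compat_def)

definition antichain :: "'a \<Rightarrow> 'a \<Rightarrow> 'a \<Rightarrow> bool" where
  "antichain P L A \<longleftrightarrow> (\<forall>z. z \<epsilon> A \<longrightarrow> z \<epsilon> P) \<and>
     (\<forall>p. p \<epsilon> A \<longrightarrow> (\<forall>q. q \<epsilon> A \<longrightarrow> p \<noteq> q \<longrightarrow> \<not> compat P L p q))"

lemma sem_antichain [simp]: "P < d \<Longrightarrow> L < d \<Longrightarrow> A < d \<Longrightarrow>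
   sm d e (is_antichain P L A) \<longleftrightarrow> antichain (e P) (e L) (e A)"
  by (simp add: is_antichain_def antichain_def)

definition linked :: "'a \<Rightarrow> 'a \<Rightarrow> 'a \<Rightarrow> bool" where
  "linked P L G \<longleftrightarrow> (\<forall>z. z \<epsilon> G \<longrightarrow> z \<epsilon> P) \<and>
     (\<forall>p. p \<epsilon> G \<longrightarrow> (\<forall>q. q \<epsilon> G \<longrightarrow> compat P L p q))"

lemma sem_linked [simp]: "P < d \<Longrightarrow> L < d \<Longrightarrow> G < d \<Longrightarrow>
   sm d e (is_2_linked P L G) \<longleftrightarrow> linked (e P) (e L) (e G)"
  by (simp add: is_2_linked_def linked_def)

definition centred :: "'a \<Rightarrow> 'a \<Rightarrow> 'a \<Rightarrow> bool" where
  "centred P L F \<longleftrightarrow> (\<forall>n s. natural n \<and> n \<noteq> empty \<and> funct s n F \<longrightarrow>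
     (\<exists>p t. p \<epsilon> P \<and> funct t n P \<and>
       (\<forall>k A a. opair k A \<epsilon> s \<and> opair k a \<epsilon> t \<longrightarrow> a \<epsilon> A \<and> opair p a \<epsilon> L)))"

lemma sem_centred [simp]: "P < d \<Longrightarrow> L < d \<Longrightarrow> F < d \<Longrightarrow>
   sm d e (is_centred P L F) \<longleftrightarrow> centred (e P) (e L) (e F)"
  by (simp add: is_centred_def centred_def)

lemma sem_generic [simp]: "F < d \<Longrightarrow> G < d \<Longrightarrow>
   sm d e (is_generic F G) \<longleftrightarrow> (\<forall>A. A \<epsilon> e F \<longrightarrow> (\<exists>a. a \<epsilon> e G \<and> a \<epsilon> A))"
  by (simp add: is_generic_def)

definition generic_principle :: bool where
  "generic_principle \<longleftrightarrow> (\<forall>P L F. porder P L \<and> (\<forall>A. A \<epsilon> F \<longrightarrow> antichain P L A \<and> fin A) \<and> centred P L F \<longrightarrow>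
     (\<exists>G. linked P L G \<and> (\<forall>A. A \<epsilon> F \<longrightarrow> (\<exists>a. a \<epsilon> G \<and> a \<epsilon> A))))"

lemma sem_Generic_2_Linked: "sm 0 e Generic_2_Linked \<longleftrightarrow> generic_principle"
  by (simp add: Generic_2_Linked_def generic_principle_def)

definition bool_alg :: "'a \<Rightarrow> 'a \<Rightarrow> 'a \<Rightarrow> 'a \<Rightarrow> 'a \<Rightarrow> 'a \<Rightarrow> bool" where
  "bool_alg B j m h e u \<longleftrightarrow> funct j (prod B B) B \<and> funct m (prod B B) B \<and> funct h B B \<and>
     bool_alg_on {x. x \<epsilon> B} (\<lambda>x y. app j (opair x y)) (\<lambda>x y. app m (opair x y)) (app h) e u"

lemma funct_app2:
  assumes "funct j (prod B B) B" "x \<epsilon> B" "y \<epsilon> B"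
  shows "opair (opair x y) z \<epsilon> j \<longleftrightarrow> z = app j (opair x y)" "app j (opair x y) \<epsilon> B"
  using funct_app[OF assms(1), of "opair x y"] assms(2,3) by simp_all

text \<open>The relational terms \<open>app1\<close> and \<open>app2\<close> collapse to
  \<open>app\<close> only when the operations are functions on \<open>B\<close>; if one of them is
  not, both sides are false.\<close>

lemma sem_bool_alg [simp]:
  assumes "B < d" "j < d" "m < d" "h < d" "z < d" "u < d"
  shows "sm d e (is_boolean_algebra B j m h z u) \<longleftrightarrow> bool_alg (e B) (e j) (e m) (e h) (e z) (e u)"
proof (cases "funct (e j) (prod (e B) (e B)) (e B) \<and> funct (e m) (prod (e B) (e B)) (e B) \<and> funct (e h) (e B) (e B)")
  case True
  then have f: "funct (e j) (prod (e B) (e B)) (e B)" "funct (e m) (prod (e B) (e B)) (e B)"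
    "funct (e h) (e B) (e B)" by auto
  show ?thesis
    unfolding bool_alg_def bool_alg_on_def is_boolean_algebra_def app2_def app1_def V_def teq_def
    using assms f
    by (simp add: funct_app2[OF f(1)] funct_app2[OF f(2)] funct_app[OF f(3)] cong: conj_cong imp_cong)
next
  case False
  then show ?thesis using assms unfolding is_boolean_algebra_def bool_alg_def by auto
qed

lemma sem_prime_ideal [simp]:
  assumes "I < d" "B < d" "j < d" "m < d" "z < d" "u < d"
    and f: "funct (e j) (prod (e B) (e B)) (e B)" "funct (e m) (prod (e B) (e B)) (e B)"
  shows "sm d e (is_prime_ideal I B j m z u) \<longleftrightarrow>
    prime_ideal {x. x \<epsilon> e B} (\<lambda>x y. app (e j) (opair x y)) (\<lambda>x y. app (e m) (opair x y))
      (e z) (e u) {x. x \<epsilon> e I}"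
\<comment> \<open>The clause on joins quantifies over \<open>I\<close>, so its terms can be
  evaluated only once \<open>I\<close> is known to lie in \<open>B\<close>.\<close>
proof (cases "\<forall>x. x \<epsilon> e I \<longrightarrow> x \<epsilon> e B")
  case True
  then show ?thesis unfolding prime_ideal_def is_prime_ideal_def app2_def V_def tmem_def using assms
    by (simp add: funct_app2[OF f(1)] funct_app2[OF f(2)] subset_iff cong: conj_cong imp_cong)
next
  case False
  then show ?thesis using assms unfolding is_prime_ideal_def prime_ideal_def by auto
qed

lemma sem_Boolean_Prime_Ideal: "sm 0 e Boolean_Prime_Ideal \<longleftrightarrow>
   (\<forall>B j m h e u. bool_alg B j m h e u \<and> e \<noteq> u \<longrightarrow>
     (\<exists>I. prime_ideal {x. x \<epsilon> B} (\<lambda>x y. app j (opair x y)) (\<lambda>x y. app m (opair x y))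
       e u {x. x \<epsilon> I}))"
  by (simp add: Boolean_Prime_Ideal_def bool_alg_def cong: conj_cong imp_cong)

subsection \<open>From generic sets to prime ideals\<close>

lemma bool_alg_prime_ideal:
  assumes generic: generic_principle and B: "bool_alg B j m h e u" and "e \<noteq> u"
  defines "J \<equiv> \<lambda>x y. app j (opair x y)" and "M \<equiv> \<lambda>x y. app m (opair x y)" and "C \<equiv> app h"
  shows "\<exists>I. prime_ideal {x. x \<epsilon> B} J M e u {x. x \<epsilon> I}"
proof -
  interpret bool_alg_on "{x. x \<epsilon> B}" J M C e u
    using B unfolding bool_alg_def J_def M_def C_def by blast
  have M_def': "DF s \<Longrightarrow> DF t \<Longrightarrow> DF (\<lambda>v. M (s v) (t v))" for s t
    unfolding M_def by (intro def_app def_opair def_fun_const)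
  have C_def': "DF s \<Longrightarrow> DF (\<lambda>v. C (s v))" for s
    unfolding C_def by (intro def_app def_fun_const)
  have cl: "M x y \<epsilon> B" "C x \<epsilon> B" if "x \<epsilon> B" "y \<epsilon> B" for x y
    using M_closed C_closed that by auto
  have e: "e \<epsilon> B" and u: "u \<epsilon> B" using e_closed u_closed by auto
  have "D (\<lambda>v. v 0 \<noteq> e)" by (intro def_terms)
  from separation[OF this] obtain P where P: "\<And>x. x \<epsilon> P \<longleftrightarrow> x \<epsilon> B \<and> x \<noteq> e" by blast
  have "D (\<lambda>v. \<exists>a b. v 0 = opair a b \<and> M a b = a)" by (intro def_terms M_def')
  from separation[OF this, of "prod P P"] obtain L where
    L': "\<And>x. x \<epsilon> L \<longleftrightarrow> x \<epsilon> prod P P \<and> (\<exists>a b. x = opair a b \<and> M a b = a)" by blast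
  have L: "opair a b \<epsilon> L \<longleftrightarrow> a \<epsilon> P \<and> b \<epsilon> P \<and> le a b" for a b
    unfolding L' le_def by auto
  define block where "block a b x \<longleftrightarrow> x \<noteq> e \<and> (x = M a b \<or> x = M a (C b) \<or> x = C a)" for a b x
  have block_def': "D (\<lambda>v. block (r v) (s v) (t v))" if "DF r" "DF s" "DF t" for r s t
    unfolding block_def by (intro def_terms M_def' C_def' that)
  have "D (\<lambda>v. \<exists>a b. a \<epsilon> B \<and> b \<epsilon> B \<and> (\<forall>x. x \<epsilon> v 0 \<longleftrightarrow> block a b x))"
    by (intro def_terms block_def')
  from separation[OF this, of "pow P"] obtain F where
    F: "\<And>X. X \<epsilon> F \<longleftrightarrow> X \<epsilon> pow P \<and> (\<exists>a b. a \<epsilon> B \<and> b \<epsilon> B \<and> (\<forall>x. x \<epsilon> X \<longleftrightarrow> block a b x))"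
    by blast
  have block_P: "x \<epsilon> P" if "block a b x" "a \<epsilon> B" "b \<epsilon> B" for a b x
    using that cl unfolding block_def P by blast
  have tr: "le x z" if "x \<epsilon> B" "y \<epsilon> B" "z \<epsilon> B" "le x y" "le y z" for x y z
    using le_trans[of x y z] that by simp
  have leM: "le (M x y) x" "le (M x y) y" if "x \<epsilon> B" "y \<epsilon> B" for x y
    using le_M1[of x y] le_M2[of x y] that by simp_all
  have po: "porder P L" unfolding porder_def
  proof (intro conjI allI impI)
    fix x assume "x \<epsilon> L" then show "x \<epsilon> prod P P" unfolding L' by (rule conjunct1)
  next
    fix p assume "p \<epsilon> P" then show "opair p p \<epsilon> L" unfolding L le_def using M_idem by (simp add: P)
  next
    fix p q assume *: "opair p q \<epsilon> L \<and> opair q p \<epsilon> L"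
    then have "p = M p q" "q = M q p" "p \<epsilon> B" "q \<epsilon> B" unfolding L le_def P by simp_all
    then show "p = q" using M_commute[of p q] by simp
  next
    fix p q r assume "opair p q \<epsilon> L \<and> opair q r \<epsilon> L"
    then show "opair p r \<epsilon> L" unfolding L using tr P by blast
  qed
  have no_lower: "False" if "r \<epsilon> P" "a \<epsilon> B" "le r a" "le r (C a)" for r a
    using le_disjoint[of r a] that by (simp add: P)
  have block_incompat: "\<not> compat P L x y" if "block a b x" "block a b y" "x \<noteq> y" "a \<epsilon> B" "b \<epsilon> B" for a b x y
  proof
    \<comment> \<open>Up to exchanging \<open>x\<close> and \<open>y\<close>, either
      \<open>x\<close> is the first block or the pair consists of the second and the third; then a
      common lower bound lies below \<open>b\<close> and \<open>C b\<close>, or below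
      \<open>a\<close> and \<open>C a\<close>.\<close>
    have *: False if r: "r \<epsilon> P" and x: "le r x" "block a b x" and y: "le r y" "block a b y"
      and "x = M a b \<or> x = M a (C b) \<and> y = C a" "x \<noteq> y" for r x y
    proof -
      have rB: "r \<epsilon> B" using r P by blast
      have ab: "C a \<epsilon> B" "C b \<epsilon> B" "M a b \<epsilon> B" "M a (C b) \<epsilon> B"
        using cl \<open>a \<epsilon> B\<close> \<open>b \<epsilon> B\<close> by auto
      have a: "le r a" if "le r (M a b) \<or> le r (M a (C b))"
        using that tr[OF rB ab(3) \<open>a \<epsilon> B\<close> _ leM(1)[OF \<open>a \<epsilon> B\<close> \<open>b \<epsilon> B\<close>]]
          tr[OF rB ab(4) \<open>a \<epsilon> B\<close> _ leM(1)[OF \<open>a \<epsilon> B\<close> ab(2)]] by blast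
      have b: "le r b" if "le r (M a b)"
        by (rule tr[OF rB ab(3) \<open>b \<epsilon> B\<close> that leM(2)[OF \<open>a \<epsilon> B\<close> \<open>b \<epsilon> B\<close>]])
      have Cb: "le r (C b)" if "le r (M a (C b))"
        by (rule tr[OF rB ab(4) ab(2) that leM(2)[OF \<open>a \<epsilon> B\<close> ab(2)]])
      consider "le r (M a b)" "le r (M a (C b))" | "le r a" "le r (C a)"
        using a x y \<open>x = _ \<or> _\<close> \<open>x \<noteq> y\<close> unfolding block_def by metis
      then show False
        using no_lower[OF r \<open>b \<epsilon> B\<close>] no_lower[OF r \<open>a \<epsilon> B\<close>] b Cb by cases blast+
    qed
    assume "compat P L x y"
    then obtain r where r: "r \<epsilon> P" "le r x" "le r y" unfolding compat_def L by blast
    have "(x = M a b \<or> x = M a (C b) \<and> y = C a) \<or> (y = M a b \<or> y = M a (C b) \<and> x = C a)"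
      using that(1-3) unfolding block_def by metis
    with *[OF r(1,2) that(1) r(3) that(2)] *[OF r(1,3) that(2) r(2) that(1)] that(3) show False
      by metis
  qed
  have anti: "antichain P L X \<and> fin X" if "X \<epsilon> F" for X
  proof -
    from that obtain a b where X: "\<forall>z. z \<epsilon> X \<longrightarrow> z \<epsilon> P" "a \<epsilon> B" "b \<epsilon> B" "\<And>x. x \<epsilon> X \<longleftrightarrow> block a b x"
      unfolding F mem_pow by blast
    have "antichain P L X" unfolding antichain_def X(4) using block_incompat[OF _ _ _ X(2,3)] block_P[OF _ X(2,3)] by blast
    moreover have "fin X" by (rule fin_three) (unfold X(4) block_def, blast)
    ultimately show ?thesis ..
  qed
  have meets: "\<exists>x. block a b x \<and> M p x \<noteq> e" if "p \<epsilon> P" "a \<epsilon> B" "b \<epsilon> B" for p a b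
  proof -
    have "M p (M a b) \<noteq> e \<or> M p (M a (C b)) \<noteq> e \<or> M p (C a) \<noteq> e"
      using partition_meets[of p a b] that by (simp add: P)
    moreover have "M p e = e" using M_e[of p] that(1) by (simp add: P)
    ultimately show ?thesis unfolding block_def by metis
  qed
  have centred: "centred P L F" unfolding centred_def
  proof (intro allI impI)
    fix n s assume *: "natural n \<and> n \<noteq> empty \<and> funct s n F"
    \<comment> \<open>The induction keeps only the lower bound \<open>p\<close> and asserts bare
      existence of members above it; the members are collected into a function afterwards. Each step
      replaces \<open>p\<close> by its meet with a block that it meets.\<close>
    define good where "good p m \<longleftrightarrow> p \<epsilon> P \<and> (\<forall>k A. k \<epsilon> m \<and> opair k A \<epsilon> s \<longrightarrow> (\<exists>a. a \<epsilon> A \<and> opair p a \<epsilon> L))" for p m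
    have "D (\<lambda>v. \<exists>p. good p (v 0))" unfolding good_def by (intro def_terms)
    from conjunct1[OF *] this have "\<exists>p. good p n"
    proof (induction rule: natural_induct)
      case empty
      have "u \<epsilon> P" using u \<open>e \<noteq> u\<close> P by blast
      then show ?case unfolding good_def by (intro exI[of _ u]) simp
    next
      case (succ m)
      then obtain p where p: "p \<epsilon> P" "\<And>k A. k \<epsilon> m \<Longrightarrow> opair k A \<epsilon> s \<Longrightarrow> \<exists>a. a \<epsilon> A \<and> opair p a \<epsilon> L"
        unfolding good_def by blast
      show ?case
      \<comment> \<open>The induction runs over all internal natural numbers, so \<open>m\<close>
        may lie beyond the domain \<open>n\<close> of \<open>s\<close>; then there is nothing to
        refine.\<close>
      proof (cases "\<exists>A. opair m A \<epsilon> s")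
        case False
        with p have "good p (succ m)" unfolding good_def by auto
        then show ?thesis by blast
      next
        case True
        then obtain A where A: "opair m A \<epsilon> s" by blast
        with * have "A \<epsilon> F" "m \<epsilon> n" using funct_sub by blast+
        then obtain a b where ab: "a \<epsilon> B" "b \<epsilon> B" "\<And>x. x \<epsilon> A \<longleftrightarrow> block a b x"
          unfolding F by blast
        obtain x where x: "block a b x" "M p x \<noteq> e" using meets[OF p(1) ab(1,2)] by blast
        have xP: "x \<epsilon> P" using block_P x(1) ab by blast
        have B: "p \<epsilon> B" "x \<epsilon> B" using p(1) xP P by auto
        have p': "M p x \<epsilon> P" using x(2) cl[OF B] P by blast
        have px: "opair (M p x) p \<epsilon> L" "opair (M p x) x \<epsilon> L" unfolding L using p' p(1) xP leM[OF B] by auto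
        have "\<exists>a. a \<epsilon> A' \<and> opair (M p x) a \<epsilon> L" if k: "k \<epsilon> succ m" "opair k A' \<epsilon> s" for k A'
        proof (cases "k = m")
          case True
          have "funct s n F" using * by blast
          from funct_app(2)[OF this \<open>m \<epsilon> n\<close>] have "A' = A" using A k(2) True by metis
          then show ?thesis using ab(3) x(1) px(2) by blast
        next
          case False
          with k p(2) obtain a' where "a' \<epsilon> A'" "opair p a' \<epsilon> L" by auto
          moreover have "opair (M p x) a' \<epsilon> L"
            using po px(1) \<open>opair p a' \<epsilon> L\<close> unfolding porder_def by blast
          ultimately show ?thesis by blast
        qed
        with p' have "good (M p x) (succ m)" unfolding good_def by blast
        then show ?thesis by blast
      qed
    qed
    then obtain p where p: "p \<epsilon> P" "\<And>k A. k \<epsilon> n \<Longrightarrow> opair k A \<epsilon> s \<Longrightarrow> \<exists>a. a \<epsilon> A \<and> opair p a \<epsilon> L"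
      unfolding good_def by blast
    have s: "funct s n F" using * by blast
    have "D (\<lambda>v. \<exists>k A a. v 0 = opair k a \<and> opair k A \<epsilon> s \<and> a \<epsilon> A \<and> opair p a \<epsilon> L)" by (intro def_terms)
    from separation[OF this, of "prod n P"] obtain t where
      t': "\<And>q. q \<epsilon> t \<longleftrightarrow> q \<epsilon> prod n P \<and> (\<exists>k A a. q = opair k a \<and> opair k A \<epsilon> s \<and> a \<epsilon> A \<and> opair p a \<epsilon> L)"
      by blast
    have t: "opair k a \<epsilon> t \<longleftrightarrow> k \<epsilon> n \<and> a \<epsilon> P \<and> a \<epsilon> app s k \<and> opair p a \<epsilon> L" for k a
      unfolding t' using funct_app(2)[OF s, of k] by auto
    have "funct t n P" unfolding funct_def
    proof (intro conjI allI impI)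
      fix q assume "q \<epsilon> t" then show "q \<epsilon> prod n P" unfolding t' by (rule conjunct1)
    next
      fix k assume k: "k \<epsilon> n"
      have A: "opair k (app s k) \<epsilon> s" "app s k \<epsilon> F" using funct_app[OF s k] by auto
      obtain a where a: "a \<epsilon> app s k" "opair p a \<epsilon> L" using p(2)[OF k A(1)] by blast
      have "c = a" if c: "c \<epsilon> app s k" "opair p c \<epsilon> L" for c
      proof (rule ccontr)
        assume "c \<noteq> a"
        then have "\<not> compat P L c a" using anti[OF A(2)] c(1) a(1) unfolding antichain_def by blast
        then show False using p(1) c(2) a(2) unfolding compat_def by blast
      qed
      then show "\<exists>b. opair k b \<epsilon> t \<and> (\<forall>c. opair k c \<epsilon> t \<longrightarrow> c = b)"
        unfolding t using k a L by blast
    qed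
    moreover have "a \<epsilon> A \<and> opair p a \<epsilon> L" if "opair k A \<epsilon> s \<and> opair k a \<epsilon> t" for k A a
    proof -
      from that have "a \<epsilon> app s k" "opair p a \<epsilon> L" "k \<epsilon> n" unfolding t by auto
      moreover have "A = app s k" using funct_app(2)[OF s \<open>k \<epsilon> n\<close>] that by blast
      ultimately show ?thesis by simp
    qed
    ultimately show "\<exists>p t. p \<epsilon> P \<and> funct t n P \<and>
       (\<forall>k A a. opair k A \<epsilon> s \<and> opair k a \<epsilon> t \<longrightarrow> a \<epsilon> A \<and> opair p a \<epsilon> L)"
      using p(1) by blast
  qed
  from generic po anti centred obtain G where
    G: "linked P L G" "\<And>A. A \<epsilon> F \<Longrightarrow> \<exists>a. a \<epsilon> G \<and> a \<epsilon> A"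
    unfolding generic_principle_def by blast
  have GP: "x \<epsilon> P" if "x \<epsilon> G" for x using G(1) that unfolding linked_def by blast
  have "prime_ideal {x. x \<epsilon> B} J M e u ({x. x \<epsilon> B} - {x. x \<epsilon> G})"
  proof (rule prime_ideal_of_linked)
    show "{x. x \<epsilon> G} \<subseteq> {x. x \<epsilon> B}" using GP P by blast
  next
    fix p q assume "p \<in> {x. x \<epsilon> G}" "q \<in> {x. x \<epsilon> G}"
    then have "compat P L p q" using G(1) unfolding linked_def by blast
    then obtain r where "r \<epsilon> P" "le r p" "le r q" unfolding compat_def L by blast
    then show "\<exists>r \<in> {x. x \<epsilon> B}. r \<noteq> e \<and> le r p \<and> le r q" using P by blast
  next
    fix a b assume "a \<in> {x. x \<epsilon> B}" "b \<in> {x. x \<epsilon> B}"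
    then have ab: "a \<epsilon> B" "b \<epsilon> B" by auto
    have "D (\<lambda>v. block a b (v 0))" by (intro block_def' def_terms)
    from separation[OF this, of P] obtain X where "\<And>x. x \<epsilon> X \<longleftrightarrow> x \<epsilon> P \<and> block a b x" by blast
    then have X: "x \<epsilon> X \<longleftrightarrow> block a b x" for x using block_P ab by blast
    then have "X \<epsilon> F" unfolding F mem_pow using ab block_P by blast
    from G(2)[OF this] show "M a b \<in> {x. x \<epsilon> G} \<or> M a (C b) \<in> {x. x \<epsilon> G} \<or> C a \<in> {x. x \<epsilon> G}"
      unfolding X block_def by blast
  qed
  moreover have "D (\<lambda>v. \<not> v 0 \<epsilon> G)" by (intro def_terms)
  from separation[OF this, of B] obtain I where "\<And>x. x \<epsilon> I \<longleftrightarrow> x \<epsilon> B \<and> \<not> x \<epsilon> G" by blast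
  then have "{x. x \<epsilon> I} = {x. x \<epsilon> B} - {x. x \<epsilon> G}" by blast
  ultimately show ?thesis by metis
qed

subsection \<open>From prime ideals to generic sets\<close>

definition inter :: "'a \<Rightarrow> 'a \<Rightarrow> 'a" where
  "inter a b = collect a (\<lambda>x. x \<epsilon> b)"

definition diff :: "'a \<Rightarrow> 'a \<Rightarrow> 'a" where
  "diff a b = collect a (\<lambda>x. \<not> x \<epsilon> b)"

lemma mem_inter [simp]: "x \<epsilon> inter a b \<longleftrightarrow> x \<epsilon> a \<and> x \<epsilon> b"
  unfolding inter_def by (rule mem_collect) (intro def_terms)

lemma mem_diff [simp]: "x \<epsilon> diff a b \<longleftrightarrow> x \<epsilon> a \<and> \<not> x \<epsilon> b"
  unfolding diff_def by (rule mem_collect) (intro def_terms)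

lemma def_inter: "DF s \<Longrightarrow> DF t \<Longrightarrow> DF (\<lambda>v. inter (s v) (t v))"
  unfolding inter_def by (intro def_collect def_terms; (assumption | erule def_fun_shift))

lemma def_diff: "DF s \<Longrightarrow> DF t \<Longrightarrow> DF (\<lambda>v. diff (s v) (t v))"
  unfolding diff_def by (intro def_collect def_terms; (assumption | erule def_fun_shift))

text \<open>The prime ideal theorem of the model speaks of operations that are sets. Definable
  operations closed on the set \<open>B\<close> become such sets, and the resulting prime ideal is
  one for the original operations since they agree on \<open>B\<close>.\<close>

lemma ex_prime_ideal:
  assumes BPI: "\<And>B j m h e u. bool_alg B j m h e u \<Longrightarrow> e \<noteq> u \<Longrightarrow>
      \<exists>I. prime_ideal {x. x \<epsilon> B} (\<lambda>x y. app j (opair x y)) (\<lambda>x y. app m (opair x y)) e u {x. x \<epsilon> I}"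
    and B: "bool_alg_on {x. x \<epsilon> B} J M C e u" and "e \<noteq> u"
    and DF: "DF (\<lambda>v. J (v 0) (v (Suc 0)))" "DF (\<lambda>v. M (v 0) (v (Suc 0)))" "DF (\<lambda>v. C (v 0))"
  shows "\<exists>I. prime_ideal {x. x \<epsilon> B} J M e u {x. x \<epsilon> I}"
proof -
  interpret bool_alg_on "{x. x \<epsilon> B}" J M C e u by (rule B)
  obtain j where j: "funct j (prod B B) B" "\<And>x y. x \<epsilon> B \<Longrightarrow> y \<epsilon> B \<Longrightarrow> app j (opair x y) = J x y"
    using ex_function2[OF DF(1), of B B B] J_closed by auto
  obtain m where m: "funct m (prod B B) B" "\<And>x y. x \<epsilon> B \<Longrightarrow> y \<epsilon> B \<Longrightarrow> app m (opair x y) = M x y"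
    using ex_function2[OF DF(2), of B B B] M_closed by auto
  obtain h where h: "funct h B B" "\<And>x. x \<epsilon> B \<Longrightarrow> app h x = C x"
    using ex_function[OF DF(3), of B B] C_closed by auto
  have "bool_alg B j m h e u" unfolding bool_alg_def
    using j(1) m(1) h(1) by (intro conjI bool_alg_on_cong[OF B]) (simp_all add: j(2) m(2) h(2))
  from BPI[OF this \<open>e \<noteq> u\<close>] obtain I where
    I: "prime_ideal {x. x \<epsilon> B} (\<lambda>x y. app j (opair x y)) (\<lambda>x y. app m (opair x y)) e u {x. x \<epsilon> I}"
    by blast
  then have sub: "x \<epsilon> B" if "x \<epsilon> I" for x using that unfolding prime_ideal_def by blast
  from I have "prime_ideal {x. x \<epsilon> B} J M e u {x. x \<epsilon> I}"
    unfolding prime_ideal_def by (simp add: j(2) m(2) sub cong: conj_cong imp_cong)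
  then show ?thesis by blast
qed

text \<open>The prime ideal theorem, applied to the quotient of the power set of \<open>P\<close> by the filter \<open>\<Phi>\<close>.
  The predicate \<open>N\<close> describes the complement of an ultrafilter containing \<open>\<Phi>\<close>.\<close>

lemma ultrafilter:
  assumes BPI: "\<And>B j m h e u. bool_alg B j m h e u \<Longrightarrow> e \<noteq> u \<Longrightarrow>
      \<exists>I. prime_ideal {x. x \<epsilon> B} (\<lambda>x y. app j (opair x y)) (\<lambda>x y. app m (opair x y)) e u {x. x \<epsilon> I}"
    and def_\<Phi>: "D (\<lambda>v. \<Phi> (v 0))"
    and \<Phi>_P: "\<Phi> P"
    and \<Phi>_inter: "\<And>X Y. \<Phi> X \<Longrightarrow> \<Phi> Y \<Longrightarrow> \<Phi> (inter X Y)"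
    and \<Phi>_proper: "\<And>X. \<Phi> X \<Longrightarrow> \<exists>p. p \<epsilon> P \<and> p \<epsilon> X"
  shows "\<exists>N. D (\<lambda>v. N (v 0)) \<and> \<not> N P \<and> (\<forall>X. \<Phi> X \<longrightarrow> N (diff P X)) \<and>
    (\<forall>S T. S \<epsilon> pow P \<and> T \<epsilon> pow P \<longrightarrow>
      (N S \<and> N T \<longrightarrow> N (union S T)) \<and> (N S \<longrightarrow> N (inter S T)) \<and> (N (inter S T) \<longrightarrow> N S \<or> N T))"
proof -
  define eqv where "eqv S T \<longleftrightarrow> (\<exists>X. \<Phi> X \<and> (\<forall>x. x \<epsilon> P \<and> x \<epsilon> X \<longrightarrow> (x \<epsilon> S \<longleftrightarrow> x \<epsilon> T)))" for S T
  define cls where "cls S = collect (pow P) (\<lambda>T. eqv S T)" for S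
  have def_eqv: "D (\<lambda>v. eqv (s v) (t v))" if "DF s" "DF t" for s t
    unfolding eqv_def
    by (intro def_terms def_rel_app1[OF def_\<Phi>] def_fun_shift[OF that(1)] def_fun_shift[OF that(2)])
  have mem_cls: "T \<epsilon> cls S \<longleftrightarrow> T \<epsilon> pow P \<and> eqv S T" for S T
    unfolding cls_def by (rule mem_collect) (intro def_eqv def_terms)
  have def_cls: "DF (\<lambda>v. cls (s v))" if "DF s" for s
    unfolding cls_def by (intro def_collect def_eqv def_pow def_fun_const def_fun_var def_fun_shift[OF that])
  have eqv_refl: "eqv S S" for S unfolding eqv_def using \<Phi>_P by blast
  have eqv_sym: "eqv T S" if "eqv S T" for S T using that unfolding eqv_def by blast
  have eqv_trans: "eqv S U" if "eqv S T" "eqv T U" for S T U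
  proof -
    from that obtain X Y where "\<Phi> X" "\<forall>x. x \<epsilon> P \<and> x \<epsilon> X \<longrightarrow> (x \<epsilon> S \<longleftrightarrow> x \<epsilon> T)"
      "\<Phi> Y" "\<forall>x. x \<epsilon> P \<and> x \<epsilon> Y \<longrightarrow> (x \<epsilon> T \<longleftrightarrow> x \<epsilon> U)"
      unfolding eqv_def by blast
    then show ?thesis unfolding eqv_def by (intro exI[of _ "inter X Y"]) (simp add: \<Phi>_inter)
  qed
  have cls_eq: "cls S = cls T \<longleftrightarrow> eqv S T" if "T \<epsilon> pow P" for S T
  proof
    assume "cls S = cls T"
    then have "T \<epsilon> cls S" using that eqv_refl mem_cls by simp
    then show "eqv S T" unfolding mem_cls by blast
  next
    assume *: "eqv S T"
    show "cls S = cls T"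
    proof (rule extensionality)
      show "U \<epsilon> cls S \<longleftrightarrow> U \<epsilon> cls T" for U
        unfolding mem_cls using eqv_trans[OF *] eqv_trans[OF eqv_sym[OF *]] by blast
    qed
  qed
  \<comment> \<open>Covers union, intersection and complement at once: membership of a point in the
    result depends only on its membership in the arguments, so the result is respected wherever the
    arguments agree.\<close>
  have cong2: "eqv (f S T) (f S' T')"
    if "eqv S S'" "eqv T T'" and f: "\<And>S T S' T' x. x \<epsilon> P \<Longrightarrow> (x \<epsilon> S \<longleftrightarrow> x \<epsilon> S') \<Longrightarrow> (x \<epsilon> T \<longleftrightarrow> x \<epsilon> T') \<Longrightarrow>
      (x \<epsilon> f S T \<longleftrightarrow> x \<epsilon> f S' T')" for f S T S' T'
  proof -
    from that(1,2) obtain X Y where "\<Phi> X" "\<forall>x. x \<epsilon> P \<and> x \<epsilon> X \<longrightarrow> (x \<epsilon> S \<longleftrightarrow> x \<epsilon> S')"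
      "\<Phi> Y" "\<forall>x. x \<epsilon> P \<and> x \<epsilon> Y \<longrightarrow> (x \<epsilon> T \<longleftrightarrow> x \<epsilon> T')"
      unfolding eqv_def by blast
    then have "\<Phi> (inter X Y) \<and> (\<forall>x. x \<epsilon> P \<and> x \<epsilon> inter X Y \<longrightarrow> (x \<epsilon> f S T \<longleftrightarrow> x \<epsilon> f S' T'))"
      using f[of _ S S' T T'] \<Phi>_inter by simp
    then show ?thesis unfolding eqv_def by blast
  qed
  \<comment> \<open>The operation on classes ranges over all representatives and takes the unique
    resulting class, so no representative has to be chosen.\<close>
  define lift where "lift f x y = the1 (\<lambda>z. \<exists>S T. S \<epsilon> x \<and> T \<epsilon> y \<and> z = cls (f S T))" for f x y
  have lift: "lift f (cls S) (cls T) = cls (f S T)"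
    if f: "\<And>S T S' T' x. x \<epsilon> P \<Longrightarrow> (x \<epsilon> S \<longleftrightarrow> x \<epsilon> S') \<Longrightarrow> (x \<epsilon> T \<longleftrightarrow> x \<epsilon> T') \<Longrightarrow>
      (x \<epsilon> f S T \<longleftrightarrow> x \<epsilon> f S' T')"
      and P: "\<And>S T. S \<epsilon> pow P \<Longrightarrow> T \<epsilon> pow P \<Longrightarrow> f S T \<epsilon> pow P"
      and "S \<epsilon> pow P" "T \<epsilon> pow P" for f S T
    unfolding lift_def
  proof (rule the1_eq)
    show "\<exists>S' T'. S' \<epsilon> cls S \<and> T' \<epsilon> cls T \<and> cls (f S T) = cls (f S' T')"
      using that(3,4) eqv_refl unfolding mem_cls by blast
  next
    fix z assume "\<exists>S' T'. S' \<epsilon> cls S \<and> T' \<epsilon> cls T \<and> z = cls (f S' T')"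
    then obtain S' T' where *: "S' \<epsilon> pow P" "eqv S S'" "T' \<epsilon> pow P" "eqv T T'" "z = cls (f S' T')"
      unfolding mem_cls by blast
    from cls_eq[OF P[OF *(1,3)], of "f S T"] cong2[OF *(2,4), of f, OF f] have "cls (f S T) = cls (f S' T')"
      by blast
    then show "z = cls (f S T)" using *(5) by simp
  qed
  have def_lift: "DF (\<lambda>v. lift f (s v) (t v))"
    if "DF s" "DF t" "\<And>s t. DF s \<Longrightarrow> DF t \<Longrightarrow> DF (\<lambda>v. f (s v) (t v))" for f s t
    unfolding lift_def
    by (intro def_terms def_cls that(3) def_fun_shift[OF that(1)] def_fun_shift[OF that(2)])
  define J where "J = lift union"
  define M where "M = lift inter"
  \<comment> \<open>The unary complement reuses the binary lift by passing its argument
    twice.\<close>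
  define C where "C x = lift (\<lambda>S T. diff P S) x x" for x
  have J: "J (cls S) (cls T) = cls (union S T)" if "S \<epsilon> pow P" "T \<epsilon> pow P" for S T
    unfolding J_def by (rule lift) (use that in auto)
  have M: "M (cls S) (cls T) = cls (inter S T)" if "S \<epsilon> pow P" "T \<epsilon> pow P" for S T
    unfolding M_def by (rule lift) (use that in auto)
  have C: "C (cls S) = cls (diff P S)" if "S \<epsilon> pow P" for S
    unfolding C_def by (rule lift) (use that in auto)
  have "D (\<lambda>v. \<exists>S. S \<epsilon> pow P \<and> v 0 = cls S)" by (intro def_terms def_cls)
  from separation[OF this, of "pow (pow P)"] obtain B where
    "\<And>x. x \<epsilon> B \<longleftrightarrow> x \<epsilon> pow (pow P) \<and> (\<exists>S. S \<epsilon> pow P \<and> x = cls S)" by blast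
  moreover have "cls S \<epsilon> pow (pow P)" for S unfolding mem_pow[of "cls S"] mem_cls by blast
  ultimately have B: "x \<epsilon> B \<longleftrightarrow> (\<exists>S. S \<epsilon> pow P \<and> x = cls S)" for x by metis
  have clsB: "cls S \<epsilon> B" if "S \<epsilon> pow P" for S using B that by blast
  have pw: "union S T \<epsilon> pow P" "inter S T \<epsilon> pow P" "diff P S \<epsilon> pow P"
    if "S \<epsilon> pow P" "T \<epsilon> pow P" for S T
    using that by auto
  have P: "P \<epsilon> pow P" "empty \<epsilon> pow P" by simp_all
  have BA: "bool_alg_on {x. x \<epsilon> B} J M C (cls empty) (cls P)"
  proof
    fix x y assume "x \<in> {x. x \<epsilon> B}" "y \<in> {x. x \<epsilon> B}"
    then obtain S T where "S \<epsilon> pow P" "x = cls S" "T \<epsilon> pow P" "y = cls T" using B by blast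
    then show "J x y \<in> {x. x \<epsilon> B}" "M x y \<in> {x. x \<epsilon> B}"
      using clsB[OF pw(1)] clsB[OF pw(2)] by (simp_all only: J M mem_Collect_eq)
  next
    fix x assume "x \<in> {x. x \<epsilon> B}"
    then obtain S where "S \<epsilon> pow P" "x = cls S" using B by blast
    then show "C x \<in> {x. x \<epsilon> B}" using clsB[OF pw(3)] by (simp only: C mem_Collect_eq)
  next
    show "cls empty \<in> {x. x \<epsilon> B}" "cls P \<in> {x. x \<epsilon> B}" using clsB P by simp_all
  next
    show "\<forall>x \<in> {x. x \<epsilon> B}. \<forall>y \<in> {x. x \<epsilon> B}. \<forall>z \<in> {x. x \<epsilon> B}.
      J x y = J y x \<and> M x y = M y x \<and>
      J x (J y z) = J (J x y) z \<and> M x (M y z) = M (M x y) z \<and>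
      J x (M x y) = x \<and> M x (J x y) = x \<and>
      J x (M y z) = M (J x y) (J x z) \<and> M x (J y z) = J (M x y) (M x z) \<and>
      J x (C x) = cls P \<and> M x (C x) = cls empty"
    proof (intro ballI)
      fix x y z assume "x \<in> {x. x \<epsilon> B}" "y \<in> {x. x \<epsilon> B}" "z \<in> {x. x \<epsilon> B}"
      then obtain S T U where S: "S \<epsilon> pow P" "T \<epsilon> pow P" "U \<epsilon> pow P"
        and xyz: "x = cls S" "y = cls T" "z = cls U" using B by blast
      have SP: "a \<epsilon> P" if "a \<epsilon> S" for a using S(1) that by simp
      \<comment> \<open>The laws already hold for the representing subsets of \<open>P\<close>, as
        equalities of sets, and are then carried to the classes.\<close>
      show "J x y = J y x \<and> M x y = M y x \<and>
        J x (J y z) = J (J x y) z \<and> M x (M y z) = M (M x y) z \<and>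
        J x (M x y) = x \<and> M x (J x y) = x \<and>
        J x (M y z) = M (J x y) (J x z) \<and> M x (J y z) = J (M x y) (M x z) \<and>
        J x (C x) = cls P \<and> M x (C x) = cls empty"
        unfolding xyz using S
        by (simp only: J M C pw, intro conjI arg_cong[of _ _ cls] extensionality) (use SP in auto)
    qed
  qed
  \<comment> \<open>Nontriviality of the quotient is properness of the filter: if the empty set and
    \<open>P\<close> agreed on some \<open>X\<close> with \<open>\<Phi> X\<close>, then
    \<open>X\<close> would miss \<open>P\<close>.\<close>
  have "cls empty \<noteq> cls P"
  proof
    assume "cls empty = cls P"
    then have "eqv empty P" using cls_eq P by blast
    then show False unfolding eqv_def using \<Phi>_proper by auto
  qed
  moreover have "DF (\<lambda>v. J (v 0) (v (Suc 0)))" unfolding J_def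
    by (rule def_lift) (rule def_fun_var def_union | assumption)+
  moreover have "DF (\<lambda>v. M (v 0) (v (Suc 0)))" unfolding M_def
    by (rule def_lift) (rule def_fun_var def_inter | assumption)+
  moreover have "DF (\<lambda>v. C (v 0))" unfolding C_def
    by (rule def_lift) (rule def_fun_var def_diff def_fun_const | assumption)+
  ultimately have "\<exists>I. prime_ideal {x. x \<epsilon> B} J M (cls empty) (cls P) {x. x \<epsilon> I}"
    by (intro ex_prime_ideal[OF _ BA] BPI)
  then obtain I where "prime_ideal {x. x \<epsilon> B} J M (cls empty) (cls P) {x. x \<epsilon> I}" by blast
  then have I: "cls empty \<epsilon> I" "\<not> cls P \<epsilon> I" "\<And>x y. x \<epsilon> I \<Longrightarrow> y \<epsilon> I \<Longrightarrow> J x y \<epsilon> I"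
    "\<And>x y. x \<epsilon> I \<Longrightarrow> y \<epsilon> B \<Longrightarrow> M x y \<epsilon> I"
    "\<And>x y. x \<epsilon> B \<Longrightarrow> y \<epsilon> B \<Longrightarrow> M x y \<epsilon> I \<Longrightarrow> x \<epsilon> I \<or> y \<epsilon> I"
    unfolding prime_ideal_def by simp_all
  have "cls (diff P X) \<epsilon> I" if "\<Phi> X" for X
  proof -
    have "eqv (diff P X) empty" unfolding eqv_def using that by (intro exI[of _ X]) simp
    then have "cls (diff P X) = cls empty" using cls_eq P(2) by blast
    with I(1) show ?thesis by simp
  qed
  moreover have "(cls S \<epsilon> I \<and> cls T \<epsilon> I \<longrightarrow> cls (union S T) \<epsilon> I) \<and> (cls S \<epsilon> I \<longrightarrow> cls (inter S T) \<epsilon> I) \<and>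
      (cls (inter S T) \<epsilon> I \<longrightarrow> cls S \<epsilon> I \<or> cls T \<epsilon> I)" if "S \<epsilon> pow P \<and> T \<epsilon> pow P" for S T
    using I(3)[of "cls S" "cls T"] I(4)[of "cls S" "cls T"] I(5)[of "cls S" "cls T"]
      J[of S T] M[of S T] clsB[of S] clsB[of T] that by metis
  moreover have "D (\<lambda>v. cls (v 0) \<epsilon> I)" by (intro def_terms def_cls)
  ultimately show ?thesis using I(2) by (intro exI[of _ "\<lambda>S. cls S \<epsilon> I"]) blast
qed

lemma generic_principle_of_prime_ideals:
  assumes BPI: "\<And>B j m h e u. bool_alg B j m h e u \<Longrightarrow> e \<noteq> u \<Longrightarrow>
      \<exists>I. prime_ideal {x. x \<epsilon> B} (\<lambda>x y. app j (opair x y)) (\<lambda>x y. app m (opair x y)) e u {x. x \<epsilon> I}"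
  shows generic_principle
  unfolding generic_principle_def
proof (intro allI impI)
  fix P L F assume *: "porder P L \<and> (\<forall>A. A \<epsilon> F \<longrightarrow> antichain P L A \<and> fin A) \<and> centred P L F"
  show "\<exists>G. linked P L G \<and> (\<forall>A. A \<epsilon> F \<longrightarrow> (\<exists>a. a \<epsilon> G \<and> a \<epsilon> A))"
  \<comment> \<open>\<open>centred\<close> speaks only of nonempty sequences. With an empty
    \<open>F\<close> it says nothing, and \<open>P\<close> may be empty and carry no proper
    filter.\<close>
  proof (cases "\<exists>A. A \<epsilon> F")
    case False
    then have "linked P L empty \<and> (\<forall>A. A \<epsilon> F \<longrightarrow> (\<exists>a. a \<epsilon> empty \<and> a \<epsilon> A))"
      by (simp add: linked_def)
    then show ?thesis by blast
  next
    case True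
    then obtain A\<^sub>0 where A\<^sub>0: "A\<^sub>0 \<epsilon> F" by blast
    define below where "below p A \<longleftrightarrow> (\<exists>a. a \<epsilon> A \<and> opair p a \<epsilon> L)" for p A
    have def_below: "D (\<lambda>v. below (s v) (t v))" if "DF s" "DF t" for s t
      unfolding below_def by (intro def_terms def_fun_shift[OF that(1)] def_fun_shift[OF that(2)])
    define good where "good s p \<longleftrightarrow> (\<forall>k A. opair k A \<epsilon> s \<longrightarrow> below p A)" for s p
    define \<Phi> where "\<Phi> X \<longleftrightarrow> (\<exists>n s. natural n \<and> funct s n F \<and> (\<forall>p. p \<epsilon> P \<longrightarrow> good s p \<longrightarrow> p \<epsilon> X))" for X
    have def_\<Phi>: "D (\<lambda>v. \<Phi> (v 0))"
      unfolding \<Phi>_def good_def funct_def mem_prod by (intro def_terms def_natural def_below)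
    have extend: "\<exists>s'. funct s' (succ n) F \<and> (\<forall>p. good s' p \<longleftrightarrow> good s p \<and> below p A)"
      if s: "funct s n F" and A: "A \<epsilon> F" for s n A
    proof -
      have "\<exists>s'. funct s' (succ n) F \<and> (\<forall>k y. opair k y \<epsilon> s' \<longleftrightarrow> opair k y \<epsilon> s \<or> k = n \<and> y = A)"
        by (rule funct_extend[OF s _ A])
      then obtain s' where s': "funct s' (succ n) F"
        "\<And>k y. opair k y \<epsilon> s' \<longleftrightarrow> opair k y \<epsilon> s \<or> k = n \<and> y = A" by blast
      have "good s' p \<longleftrightarrow> good s p \<and> below p A" for p unfolding good_def s'(2) by blast
      with s'(1) show ?thesis by blast
    qed
    have good_empty: "good empty p" for p by (simp add: good_def)
    have \<Phi>_P: "\<Phi> P" unfolding \<Phi>_def using natural_empty funct_empty by blast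
    have \<Phi>_below: "\<Phi> X" if A: "A \<epsilon> F" and X: "\<And>p. p \<epsilon> P \<Longrightarrow> below p A \<Longrightarrow> p \<epsilon> X" for A X
    proof -
      obtain s where "funct s (succ empty) F" "\<And>p. good s p \<longleftrightarrow> below p A"
        using extend[OF funct_empty A] good_empty by blast
      then show ?thesis unfolding \<Phi>_def using natural_succ[OF natural_empty] X by blast
    qed
    have \<Phi>_inter: "\<Phi> (inter X Y)" if "\<Phi> X" "\<Phi> Y" for X Y
    proof -
      from that obtain n s n' s' where s: "natural n" "funct s n F" "\<And>p. p \<epsilon> P \<Longrightarrow> good s p \<Longrightarrow> p \<epsilon> X"
        and s': "natural n'" "funct s' n' F" "\<And>p. p \<epsilon> P \<Longrightarrow> good s' p \<Longrightarrow> p \<epsilon> Y"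
        unfolding \<Phi>_def by blast
      \<comment> \<open>Joins \<open>s\<close> and \<open>s'\<close> without defining concatenation:
        some sequence imposes the conditions of \<open>s\<close> and those of the entries of
        \<open>s'\<close> with index in \<open>m\<close>. This is definable, so induction on
        \<open>m\<close> applies.\<close>
      define R where "R m \<longleftrightarrow> (\<exists>l r. natural l \<and> funct r l F \<and> (\<forall>p. good r p \<longrightarrow>
        good s p \<and> (\<forall>k A. k \<epsilon> m \<and> opair k A \<epsilon> s' \<longrightarrow> below p A)))" for m
      have "D (\<lambda>v. R (v 0))"
        unfolding R_def good_def funct_def mem_prod by (intro def_terms def_natural def_below)
      with s'(1) have "R n'"
      proof (induction rule: natural_induct)
        case empty
        show ?case unfolding R_def using s(1,2) by (intro exI[of _ n] exI[of _ s]) simp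
      next
        case (succ m)
        then obtain l r where r: "natural l" "funct r l F"
          "\<And>p. good r p \<Longrightarrow> good s p" "\<And>p k A. good r p \<Longrightarrow> k \<epsilon> m \<Longrightarrow> opair k A \<epsilon> s' \<Longrightarrow> below p A"
          unfolding R_def by blast
        show ?case
        proof (cases "\<exists>A. opair m A \<epsilon> s'")
          case False
          have "below p A" if "good r p" "k \<epsilon> succ m" "opair k A \<epsilon> s'" for p k A
            using r(4)[OF that(1) _ that(3)] that(2,3) False by auto
          with r show ?thesis unfolding R_def by blast
        next
          case True
          then obtain A where A: "opair m A \<epsilon> s'" by blast
          have m: "m \<epsilon> n'" "A \<epsilon> F" using funct_sub[OF s'(2) A] by auto
          obtain r' where r': "funct r' (succ l) F" "\<And>p. good r' p \<longleftrightarrow> good r p \<and> below p A"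
            using extend[OF r(2) m(2)] by blast
          have "below p A'" if "good r' p" "k \<epsilon> succ m" "opair k A' \<epsilon> s'" for p k A'
          proof (cases "k = m")
            case True
            then have "A' = A" using funct_app(2)[OF s'(2) m(1)] A that(3) by metis
            with that(1) r'(2) show ?thesis by blast
          next
            case False
            with r(4)[of p k A'] that r'(2) show ?thesis by auto
          qed
          with r(3) r' natural_succ[OF r(1)] show ?thesis unfolding R_def by blast
        qed
      qed
      then obtain l r where r: "natural l" "funct r l F" "\<And>p. good r p \<Longrightarrow> good s p"
        "\<And>p k A. good r p \<Longrightarrow> k \<epsilon> n' \<Longrightarrow> opair k A \<epsilon> s' \<Longrightarrow> below p A"
        unfolding R_def by blast
      have "good s' p" if "good r p" for p
        unfolding good_def using r(4)[OF that] funct_sub[OF s'(2)] by blast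
      with s(3) s'(3) r show ?thesis unfolding \<Phi>_def mem_inter by blast
    qed
    have \<Phi>_proper: "\<exists>p. p \<epsilon> P \<and> p \<epsilon> X" if X: "\<Phi> X" for X
    proof -
      from X obtain n s where s: "natural n" "funct s n F" "\<And>p. p \<epsilon> P \<Longrightarrow> good s p \<Longrightarrow> p \<epsilon> X"
        unfolding \<Phi>_def by blast
      \<comment> \<open>Appending \<open>A\<^sub>0\<close> makes the sequence nonempty, as
        \<open>centred\<close> requires, and only strengthens the condition
        \<open>good\<close>.\<close>
      obtain s' where s': "funct s' (succ n) F" "\<And>p. good s' p \<longleftrightarrow> good s p \<and> below p A\<^sub>0"
        using extend[OF s(2) A\<^sub>0] by blast
      have "\<exists>p t. p \<epsilon> P \<and> funct t (succ n) P \<and>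
          (\<forall>k A a. opair k A \<epsilon> s' \<and> opair k a \<epsilon> t \<longrightarrow> a \<epsilon> A \<and> opair p a \<epsilon> L)"
        using conjunct2[OF conjunct2[OF *]] natural_succ[OF s(1)] succ_nonempty s'(1)
        unfolding centred_def by blast
      then obtain p t where p: "p \<epsilon> P" and t: "funct t (succ n) P"
        "\<And>k A a. opair k A \<epsilon> s' \<Longrightarrow> opair k a \<epsilon> t \<Longrightarrow> a \<epsilon> A \<and> opair p a \<epsilon> L" by blast
      have "good s' p" unfolding good_def
      proof (intro allI impI)
        fix k A assume k: "opair k A \<epsilon> s'"
        then have "k \<epsilon> succ n" using funct_sub[OF s'(1)] by blast
        from funct_ex[OF t(1) this] obtain a where "opair k a \<epsilon> t" by blast
        from t(2)[OF k this] show "below p A" unfolding below_def by blast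
      qed
      with p s(3) s'(2) show ?thesis by blast
    qed
    have "\<exists>N. D (\<lambda>v. N (v 0)) \<and> \<not> N P \<and> (\<forall>X. \<Phi> X \<longrightarrow> N (diff P X)) \<and>
      (\<forall>S T. S \<epsilon> pow P \<and> T \<epsilon> pow P \<longrightarrow>
        (N S \<and> N T \<longrightarrow> N (union S T)) \<and> (N S \<longrightarrow> N (inter S T)) \<and> (N (inter S T) \<longrightarrow> N S \<or> N T))"
      by (rule ultrafilter) (fact BPI def_\<Phi> \<Phi>_P \<Phi>_inter \<Phi>_proper)+
    then obtain N where def_N: "D (\<lambda>v. N (v 0))" and N_P: "\<not> N P" and N_diff: "\<forall>X. \<Phi> X \<longrightarrow> N (diff P X)"
      and N': "\<forall>S T. S \<epsilon> pow P \<and> T \<epsilon> pow P \<longrightarrow>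
        (N S \<and> N T \<longrightarrow> N (union S T)) \<and> (N S \<longrightarrow> N (inter S T)) \<and> (N (inter S T) \<longrightarrow> N S \<or> N T)"
      by (elim exE conjE) (rule that; assumption)
    have N_\<Phi>: "N (diff P X)" if "\<Phi> X" for X using N_diff that by blast
    have N: "N S \<Longrightarrow> N T \<Longrightarrow> N (union S T)" "N S \<Longrightarrow> N (inter S T)" "N (inter S T) \<Longrightarrow> N S \<or> N T"
      if "S \<epsilon> pow P" "T \<epsilon> pow P" for S T
      using N'[rule_format, of S T] that by simp_all
    \<comment> \<open>Closure under meets with arbitrary subsets of \<open>P\<close> is downward
      closure, since \<open>T\<close> is its own intersection with \<open>S\<close>.\<close>
    have N_sub: "N T" if "N S" "S \<epsilon> pow P" "\<And>z. z \<epsilon> T \<Longrightarrow> z \<epsilon> S" for S T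
    proof -
      have "T \<epsilon> pow P" using that(2,3) by simp
      moreover have "inter S T = T" by (rule extensionality) (use that(3) in auto)
      ultimately show ?thesis using N(2)[OF that(2) _ that(1), of T] by simp
    qed
    have N_empty: "N empty" by (rule N_sub[OF N_\<Phi>[OF \<Phi>_P]]) simp_all
    define down where "down a = collect P (\<lambda>p. opair p a \<epsilon> L)" for a
    have down: "p \<epsilon> down a \<longleftrightarrow> p \<epsilon> P \<and> opair p a \<epsilon> L" for p a
      unfolding down_def by (rule mem_collect) (intro def_terms)
    have def_down: "DF (\<lambda>v. down (v 0))"
      unfolding down_def by (intro def_collect def_terms)
    have down_pow: "down a \<epsilon> pow P" for a by (simp add: down)
    have "D (\<lambda>v. \<not> N (down (v 0)))" by (intro def_not def_rel_app1[OF def_N] def_down)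
    from separation[OF this, of P] obtain G where G: "\<And>a. a \<epsilon> G \<longleftrightarrow> a \<epsilon> P \<and> \<not> N (down a)" by blast
    \<comment> \<open>Incompatible elements have disjoint cones; by primeness one of these would
      satisfy \<open>N\<close>, as the empty set does.\<close>
    have "compat P L a b" if "a \<epsilon> G" "b \<epsilon> G" for a b
    proof (rule ccontr)
      assume "\<not> compat P L a b"
      then have "inter (down a) (down b) = empty"
        by (intro extensionality) (auto simp: down compat_def)
      then show False using N(3)[OF down_pow down_pow, of a b] N_empty that G by simp
    qed
    then have "linked P L G" unfolding linked_def using G by blast
    moreover have "\<exists>a. a \<epsilon> G \<and> a \<epsilon> A" if A: "A \<epsilon> F" for A
    proof (rule ccontr)
      assume no: "\<not> (\<exists>a. a \<epsilon> G \<and> a \<epsilon> A)"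
      have "a \<epsilon> P" if "a \<epsilon> A" for a using * A that unfolding antichain_def by blast
      then have N_down: "N (down a)" if "a \<epsilon> A" for a using no that G by blast
      have "fin A" using * A by blast
      then obtain n f where f: "natural n" "funct f n A" "\<And>a. a \<epsilon> A \<Longrightarrow> \<exists>k. opair k a \<epsilon> f"
        unfolding fin_def by blast
      \<comment> \<open>The union of the cones of the members of \<open>A\<close> enumerated by
        \<open>f\<close> at indices in \<open>m\<close>. Finiteness of \<open>A\<close> is used
        here: binary closure of \<open>N\<close> under unions reaches all of \<open>A\<close> by
        internal induction along the enumeration.\<close>
      define U where "U m = collect P (\<lambda>p. \<exists>k a. k \<epsilon> m \<and> opair k a \<epsilon> f \<and> opair p a \<epsilon> L)" for m
      have U: "p \<epsilon> U m \<longleftrightarrow> p \<epsilon> P \<and> (\<exists>k a. k \<epsilon> m \<and> opair k a \<epsilon> f \<and> opair p a \<epsilon> L)" for p m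
        unfolding U_def by (rule mem_collect) (intro def_terms)
      have def_U: "DF (\<lambda>v. U (v 0))" unfolding U_def by (intro def_collect def_terms)
      have U_pow: "U m \<epsilon> pow P" for m by (simp add: U)
      have "D (\<lambda>v. N (U (v 0)))" by (rule def_rel_app1[OF def_N def_U])
      with f(1) have "N (U n)"
      proof (induction rule: natural_induct)
        case empty
        have "U empty = empty" by (rule extensionality) (simp add: U)
        with N_empty show ?case by simp
      next
        case (succ m)
        show ?case
        proof (cases "\<exists>a. opair m a \<epsilon> f")
          case False
          show ?thesis by (rule N_sub[OF succ(2) U_pow]) (use False in \<open>auto simp: U\<close>)
        next
          case True
          then obtain a where a: "opair m a \<epsilon> f" by blast
          have ma: "m \<epsilon> n" "a \<epsilon> A" using funct_sub[OF f(2) a] by auto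
          have uniq: "a' = a" if "opair m a' \<epsilon> f" for a'
            using that a funct_app(2)[OF f(2) ma(1)] by metis
          show ?thesis
          proof (rule N_sub)
            show "N (union (U m) (down a))" using N(1)[OF U_pow down_pow succ(2) N_down[OF ma(2)]] .
            show "union (U m) (down a) \<epsilon> pow P" by (simp add: U down)
            show "z \<epsilon> union (U m) (down a)" if "z \<epsilon> U (succ m)" for z
              using that uniq by (auto simp: U down)
          qed
        qed
      qed
      \<comment> \<open>All of \<open>A\<close> is enumerated, so \<open>U n\<close> contains a
        generator of the filter and its complement satisfies \<open>N\<close>. Together with
        \<open>N (U n)\<close> this would force \<open>N P\<close>.\<close>
      have "\<Phi> (U n)"
      proof (rule \<Phi>_below[OF A])
        fix p assume p: "p \<epsilon> P" "below p A"
        then obtain a where a: "a \<epsilon> A" "opair p a \<epsilon> L" unfolding below_def by blast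
        from f(3)[OF a(1)] obtain k where k: "opair k a \<epsilon> f" by blast
        with funct_sub[OF f(2) k] p(1) a(2) show "p \<epsilon> U n" unfolding U by blast
      qed
      then have "N (diff P (U n))" by (rule N_\<Phi>)
      with \<open>N (U n)\<close> have "N (union (U n) (diff P (U n)))" by (intro N(1) U_pow) auto
      then have "N P" by (rule N_sub) (auto simp: U)
      with N_P show False by blast
    qed
    ultimately show ?thesis by blast
  qed
qed

end

theorem theorem3p4:
  shows "ZF \<turnstile> (Boolean_Prime_Ideal \<^bold>\<longleftrightarrow> Generic_2_Linked) 0"
proof (rule ZF_complete)
  fix E :: "nat \<Rightarrow> nat \<Rightarrow> bool" and v
  assume "\<And>q. q \<in> ZF \<Longrightarrow> sat E v q"
  then interpret zf_model E v by unfold_locales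
  have "sm 0 e (Boolean_Prime_Ideal \<^bold>\<longleftrightarrow> Generic_2_Linked)" for e
    unfolding sem_iff sem_Boolean_Prime_Ideal sem_Generic_2_Linked
    using bool_alg_prime_ideal generic_principle_of_prime_ideals by blast
  then show "sat E v ((Boolean_Prime_Ideal \<^bold>\<longleftrightarrow> Generic_2_Linked) 0)"
    by (simp add: sem_def env_def)
qed

end
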